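(* Under the assumptions of the context, with the system in stationarity, let $M^{(c)}$ be the number of type-$c$ customers present (active or inactive). Let $g_j$ denote the type of the customer holding $T_j$ and $G_{c_1,\dots,c_i}(T_1,n_1,\dots,T_i,n_i)=\mathbb P\big(g_j=c_j\ \forall j\le i\mid \text{state}=(T_1,n_1,\dots,T_i,n_i)\big)$ (stationary conditional probability). With $\theta_{c,j}=\lambda_c\mathbf 1\{c\in\mathcal U(\{T_1,\dots,T_j\})\}/\lambda_{\mathcal U(\{T_1,\dots,T_j\})}$ (zero if the denominator vanishes), for complex $|z_c|<1$, $$\mathbb E\Big[\prod_{c}z_c^{M^{(c)}}\Big]=\sum_{i=0}^K\sum_{(T_1,\dots,T_i)}\pi((0))\frac{\Pi_\lambda(\{T_1,\dots,T_i\})}{\Pi_k(T_1,\dots,T_i)}\prod_{j=1}^i\frac1{\eta(j)}\sum_{(n_1,\dots,n_i)\in\mathbb N_0^i}\Big(\sum_{(c_1,\dots,c_i)\in\mathcal C^i}G_{c_1,\dots,c_i}(T_1,n_1,\dots,T_i,n_i)\prod_{j=1}^i z_{c_j}\Big)\prod_{m=1}^{\sum_l n_l}\frac1{\eta(i+m)}\prod_{j=1}^i\Big(\alpha_j\sum_{c}\theta_{c,j}z_c\Big)^{n_j},$$ the sum over tuples running over ordered tuples of distinct tokens.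
   Context: Token-based central queue. There is a finite set $\mathcal C$ of customer types; type-$c$ customers arrive according to independent Poisson processes with rates $\lambda_c>0$. There is a finite set of tokens $\mathcal T=\{t_1,\dots,t_K\}$; each type $c$ has a nonempty set $\mathcal T_c\subseteq\mathcal T$ of compatible tokens, and $\mathcal C_t=\{c: t\in\mathcal T_c\}$. A customer can receive service only while it holds a token ("active"); tokenless customers ("inactive") wait in a central queue and have departure rate $0$. An arriving type-$c$ customer that finds at least one available token in $\mathcal T_c$ immediately claims one of them according to a randomised assignment rule depending on the set of unavailable tokens and on the type; otherwise it waits. When a customer departs, its token is immediately claimed by the longest-waiting tokenless customer whose type lies in $\mathcal C_t$; if there is none, the token becomes available. State: $(0)$ (empty) or $x=(T_1,n_1,\dots,T_i,n_i)$, with $T_1,\dots,T_i$ the distinct claimed tokens in order of arrival of their holders and $n_j$ the number of tokenless customers that arrived between the holders of $T_j$ and $T_{j+1}$ (after the holder of $T_i$ for $j=i$). For $\mathcal R\subseteq\mathcal T$, $\mathcal U(\mathcal R)=\{c:\mathcal T_c\subseteq\mathcal R\}$, $\lambda_{\mathcal U(\mathcal R)}=\sum_{c\in\mathcal U(\mathcal R)}\lambda_c$; $\lambda_t(\mathcal R)$ is the rate at which arrivals claim token $t\notin\mathcal R$ when $\mathcal R$ is the set of unavailable tokens. Assignment condition: $\prod_{j=1}^i\lambda_{T_j}(\{T_1,\dots,T_{j-1}\})$ is permutation invariant for distinct $T_1,\dots,T_i$; its value is $\Pi_\lambda(\{T_1,\dots,T_i\})$. Order-independent condition: holder of $T_j$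 departs at rate $\eta(\phi(x))s_j(T_1,\dots,T_j)$, $\phi(x)=i+\sum_jn_j$, $s_j\ge0$, $k(T_1,\dots,T_i)=\sum_j s_j(T_1,\dots,T_j)$ permutation invariant and $>0$ for nonempty tuples, $\eta(m)>0$. $\Pi_k(T_1,\dots,T_i)=\prod_{j=1}^ik(T_1,\dots,T_j)$, $\alpha_j=\lambda_{\mathcal U(\{T_1,\dots,T_j\})}/k(T_1,\dots,T_j)$, $0^0=1$. Standing assumptions: both conditions hold, the process is positive recurrent, with stationary distribution $\pi(x)=\pi((0))\frac{\Pi_\lambda(\{T_1,\dots,T_i\})}{\Pi_k(T_1,\dots,T_i)}\prod_{j}\alpha_j^{n_j}\prod_{m=1}^{\phi(x)}\eta(m)^{-1}$. *)

theory Defs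
  imports "HOL-Analysis.Analysis"
begin

text \<open>Detailed state of the token-based central queue: the list of all customers present,
  in order of arrival; each entry is (type, held token) where None means tokenless (inactive).\<close>
type_synonym ('c, 't) dstate = "('c \<times> 't option) list"

definition active :: "'c \<times> 't option \<Rightarrow> bool" where
  "active e \<longleftrightarrow> snd e \<noteq> None"

definition toks :: "('c, 't) dstate \<Rightarrow> 't list" where
  "toks x = map (the \<circ> snd) (filter active x)"

definition htypes :: "('c, 't) dstate \<Rightarrow> 'c list" where
  "htypes x = map fst (filter active x)"

definition ncust :: "'c \<Rightarrow> ('c, 't) dstate \<Rightarrow> nat" where
  "ncust c x = length (filter (\<lambda>e. fst e = c) x)"

text \<open>Aggregated state (T_1,n_1,...,T_i,n_i), encoded as the pair of lists
  ([T_1,...,T_i],[n_1,...,n_i]); the empty state (0) is ([],[]).\<close>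
fun agg :: "('c, 't) dstate \<Rightarrow> 't list \<times> nat list" where
  "agg [] = ([], [])"
| "agg ((c, Some t) # xs) =
     (t # fst (agg xs), length (takeWhile (\<lambda>e. snd e = None) xs) # snd (agg xs))"
| "agg ((c, None) # xs) = agg xs"

definition lamU :: "('c::finite \<Rightarrow> real) \<Rightarrow> ('c \<Rightarrow> 't set) \<Rightarrow> 't set \<Rightarrow> real" where
  "lamU lam Tc R = (\<Sum>c\<in>{c. Tc c \<subseteq> R}. lam c)"

text \<open>lambda_t(R): rate at which arrivals claim token t when R is the set of unavailable tokens;
  assign c R t is the probability that an arriving type-c customer claims t.\<close>
definition lam_tok :: "('c::finite \<Rightarrow> real) \<Rightarrow> ('c \<Rightarrow> 't set \<Rightarrow> 't \<Rightarrow> real) \<Rightarrow> 't set \<Rightarrow> 't \<Rightarrow> real" where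
  "lam_tok lam assign R t = (\<Sum>c\<in>UNIV. lam c * assign c R t)"

definition prodlam :: "('c::finite \<Rightarrow> real) \<Rightarrow> ('c \<Rightarrow> 't set \<Rightarrow> 't \<Rightarrow> real) \<Rightarrow> 't list \<Rightarrow> real" where
  "prodlam lam assign ts = (\<Prod>j<length ts. lam_tok lam assign (set (take j ts)) (ts ! j))"

definition Pi_lam :: "('c::finite \<Rightarrow> real) \<Rightarrow> ('c \<Rightarrow> 't set \<Rightarrow> 't \<Rightarrow> real) \<Rightarrow> 't set \<Rightarrow> real" where
  "Pi_lam lam assign S = prodlam lam assign (SOME xs. distinct xs \<and> set xs = S)"

text \<open>s ts = s_j(T_1,...,T_j) for ts = [T_1,...,T_j].\<close>
definition kf :: "('t list \<Rightarrow> real) \<Rightarrow> 't list \<Rightarrow> real" where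
  "kf s ts = (\<Sum>j=1..length ts. s (take j ts))"

definition Pi_k :: "('t list \<Rightarrow> real) \<Rightarrow> 't list \<Rightarrow> real" where
  "Pi_k s ts = (\<Prod>j=1..length ts. kf s (take j ts))"

definition alpha :: "('c::finite \<Rightarrow> real) \<Rightarrow> ('c \<Rightarrow> 't set) \<Rightarrow> ('t list \<Rightarrow> real) \<Rightarrow> 't list \<Rightarrow> nat \<Rightarrow> real" where
  "alpha lam Tc s ts j = lamU lam Tc (set (take j ts)) / kf s (take j ts)"

definition theta :: "('c::finite \<Rightarrow> real) \<Rightarrow> ('c \<Rightarrow> 't set) \<Rightarrow> 't list \<Rightarrow> nat \<Rightarrow> 'c \<Rightarrow> real" where
  "theta lam Tc ts j c =
     (if lamU lam Tc (set (take j ts)) = 0 then 0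
      else (if Tc c \<subseteq> set (take j ts) then lam c else 0) / lamU lam Tc (set (take j ts)))"

definition after_dep :: "('c \<Rightarrow> 't set) \<Rightarrow> ('c, 't) dstate \<Rightarrow> nat \<Rightarrow> ('c, 't) dstate" where
  "after_dep Tc x k =
     (let t = the (snd (x ! k)); y = take k x @ drop (Suc k) x in
      if \<exists>l<length y. snd (y ! l) = None \<and> t \<in> Tc (fst (y ! l))
      then (let l = (LEAST l. l < length y \<and> snd (y ! l) = None \<and> t \<in> Tc (fst (y ! l)))
            in y[l := (fst (y ! l), Some t)])
      else y)"

text \<open>Departure rate of the active customer at position k (holder of T_j, j its rank among
  active customers): eta(phi(x)) * s_j(T_1,...,T_j).\<close>
definition dep_rate :: "('t list \<Rightarrow> real) \<Rightarrow> (nat \<Rightarrow> real) \<Rightarrow> ('c, 't) dstate \<Rightarrow> nat \<Rightarrow> real" where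
  "dep_rate s eta x k = eta (length x) * s (toks (take (Suc k) x))"

definition qrate :: "('c::finite \<Rightarrow> real) \<Rightarrow> ('c \<Rightarrow> 't::finite set) \<Rightarrow> ('c \<Rightarrow> 't set \<Rightarrow> 't \<Rightarrow> real)
    \<Rightarrow> ('t list \<Rightarrow> real) \<Rightarrow> (nat \<Rightarrow> real) \<Rightarrow> ('c, 't) dstate \<Rightarrow> ('c, 't) dstate \<Rightarrow> real" where
  "qrate lam Tc assign s eta x y =
     (\<Sum>c\<in>UNIV.
        if Tc c - set (toks x) \<noteq> {}
        then (\<Sum>t\<in>UNIV. lam c * assign c (set (toks x)) t * (if y = x @ [(c, Some t)] then 1 else 0))
        else lam c * (if y = x @ [(c, None)] then 1 else 0))
   + (\<Sum>k<length x. if active (x ! k) \<and> y = after_dep Tc x k then dep_rate s eta x k else 0)"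

definition outrate :: "('c::finite \<Rightarrow> real) \<Rightarrow> ('t list \<Rightarrow> real) \<Rightarrow> (nat \<Rightarrow> real) \<Rightarrow> ('c, 't) dstate \<Rightarrow> real" where
  "outrate lam s eta x = (\<Sum>c\<in>UNIV. lam c) + (\<Sum>k<length x. if active (x ! k) then dep_rate s eta x k else 0)"

definition stationary :: "('c::finite \<Rightarrow> real) \<Rightarrow> ('c \<Rightarrow> 't::finite set) \<Rightarrow> ('c \<Rightarrow> 't set \<Rightarrow> 't \<Rightarrow> real)
    \<Rightarrow> ('t list \<Rightarrow> real) \<Rightarrow> (nat \<Rightarrow> real) \<Rightarrow> (('c, 't) dstate \<Rightarrow> real) \<Rightarrow> bool" where
  "stationary lam Tc assign s eta p \<longleftrightarrow>
     (\<forall>x. p x \<ge> 0) \<and> (p has_sum 1) UNIV \<and>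
     (\<forall>x. (\<Sum>\<^sub>\<infinity>y. p y * qrate lam Tc assign s eta y x) = p x * outrate lam s eta x) \<and>
     (\<forall>x. \<not> (\<lambda>u v. qrate lam Tc assign s eta u v > 0)\<^sup>*\<^sup>* [] x \<longrightarrow> p x = 0)"

definition pagg :: "(('c, 't) dstate \<Rightarrow> real) \<Rightarrow> 't list \<Rightarrow> nat list \<Rightarrow> real" where
  "pagg p ts ns = (\<Sum>\<^sub>\<infinity>x\<in>{x. agg x = (ts, ns)}. p x)"

definition Gcond :: "(('c, 't) dstate \<Rightarrow> real) \<Rightarrow> 'c list \<Rightarrow> 't list \<Rightarrow> nat list \<Rightarrow> real" where
  "Gcond p cs ts ns = (\<Sum>\<^sub>\<infinity>x\<in>{x. agg x = (ts, ns) \<and> htypes x = cs}. p x) / pagg p ts ns"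

end

theory Submission
  imports Defs
begin

text \<open>
  The skeleton of a detailed state forgets the types of the tokenless customers. Call a function of
  the state skeletal if it is a function of the skeleton times the product of the arrival rates
  \<open>lam c\<close> over the tokenless customers, cut off to the states in which each of them is compatible
  only with tokens held in front of it. The key fact is that the stationary distribution \<open>p\<close> is
  skeletal, i.e. that given the skeleton the tokenless types are independent with law \<open>theta\<close>; the
  generating function then follows by summing over skeletons.

  The inflow operator \<open>u \<mapsto> (\<lambda>x. \<Sum>y. u y * q y x)\<close> preserves skeletal functions: in the support a
  departing token \<open>t\<close> finds no compatible customer in front of its holder, and inserting the holder
  of \<open>t\<close> in front of customers that cannot use \<open>t\<close> does not change their constraints.
  Iterating the balance equations away from the empty state, where the value is kept at \<open>p []\<close>,
  gives an increasing sequence of skeletal functions below \<open>p\<close>. Its limit \<open>g\<close> equals \<open>p\<close>: for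
  \<open>d = p - g\<close> the net flow between the states with \<open>n\<close> and those with \<open>n + 1\<close> customers does not
  depend on \<open>n\<close>, and it is bounded by the downward flow of \<open>p\<close>, which tends to \<open>0\<close> even if the
  rates are unbounded. So it vanishes, and \<open>d = 0\<close> follows level by level, starting from \<open>d [] = 0\<close>.
\<close>

section \<open>Skeletons of detailed states\<close>

text \<open>The types of the token holders are kept since the probabilities \<open>Gcond\<close>
  refer to them; an entry \<open>None\<close> is a tokenless customer.\<close>

definition sk :: "('c, 't) dstate \<Rightarrow> ('c \<times> 't) option list" where
  "sk x = map (\<lambda>e. map_option (Pair (fst e)) (snd e)) x"

definition sk_toks :: "('c \<times> 't) option list \<Rightarrow> 't list" where
  "sk_toks m = map (snd \<circ> the) (filter (\<lambda>e. e \<noteq> None) m)"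

lemma length_sk [simp]: "length (sk x) = length x"
  by (simp add: sk_def)

lemma sk_simps [simp]:
  "sk [] = []" "sk (e # x) = map_option (Pair (fst e)) (snd e) # sk x" "sk (x @ y) = sk x @ sk y"
  by (simp_all add: sk_def)

lemma sk_take: "sk (take k x) = take k (sk x)"
  by (simp add: sk_def take_map)

lemma sk_drop: "sk (drop k x) = drop k (sk x)"
  by (simp add: sk_def drop_map)

lemma sk_eq_Nil_iff [simp]: "sk x = [] \<longleftrightarrow> x = []"
  by (simp add: sk_def)

lemma toks_simps [simp]:
  "toks [] = []" "toks ((c, Some t) # x) = t # toks x" "toks ((c, None) # x) = toks x"
  "toks (x @ y) = toks x @ toks y"
  by (simp_all add: toks_def active_def)

lemma toks_eq_sk_toks: "toks x = sk_toks (sk x)"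
proof (induction x)
  case (Cons e x)
  then show ?case by (cases e; cases "snd e") (auto simp: sk_toks_def toks_def active_def)
qed (simp add: sk_toks_def)

section \<open>Weights of states and the insertion of token holders\<close>

fun wt :: "('c \<Rightarrow> real) \<Rightarrow> ('c \<Rightarrow> 't set) \<Rightarrow> 't set \<Rightarrow> ('c, 't) dstate \<Rightarrow> real" where
  "wt lam Tc S [] = 1"
| "wt lam Tc S ((c, Some t) # x) = (if t \<in> S then 0 else wt lam Tc (insert t S) x)"
| "wt lam Tc S ((c, None) # x) = (if Tc c \<subseteq> S then lam c else 0) * wt lam Tc S x"

lemma wt_append: "wt lam Tc S (x @ y) = wt lam Tc S x * wt lam Tc (S \<union> set (toks x)) y"
  by (induction lam Tc S x rule: wt.induct) auto

lemma wt_nonneg: "(\<And>c. lam c \<ge> 0) \<Longrightarrow> wt lam Tc S x \<ge> 0"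
  by (induction lam Tc S x rule: wt.induct) auto

lemma wt_distinct: "wt lam Tc S x \<noteq> 0 \<Longrightarrow> distinct (toks x) \<and> set (toks x) \<inter> S = {}"
  by (induction lam Tc S x rule: wt.induct) (auto split: if_splits)

definition incompat :: "('c \<Rightarrow> 't set) \<Rightarrow> 't \<Rightarrow> ('c, 't) dstate \<Rightarrow> bool" where
  "incompat Tc t x \<longleftrightarrow> (\<forall>e\<in>set x. snd e = None \<longrightarrow> t \<notin> Tc (fst e))"

lemma incompat_simps [simp]:
  "incompat Tc t []"
  "incompat Tc t (e # x) \<longleftrightarrow> (snd e = None \<longrightarrow> t \<notin> Tc (fst e)) \<and> incompat Tc t x"
  "incompat Tc t (x @ y) \<longleftrightarrow> incompat Tc t x \<and> incompat Tc t y"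
  by (auto simp: incompat_def)

lemma not_incompatE:
  assumes "\<not> incompat Tc t x"
  obtains y c z where "x = y @ (c, None) # z" "t \<in> Tc c"
proof -
  obtain e where e: "e \<in> set x" "snd e = None" "t \<in> Tc (fst e)"
    using assms unfolding incompat_def by blast
  then obtain y z where "x = y @ e # z" by (meson split_list)
  then show thesis using e that[of y "fst e" z] by (cases e) simp
qed

text \<open>Adding \<open>t\<close> to \<open>S\<close> relaxes the constraint
  \<open>Tc c \<subseteq> S\<close> only for types that can use \<open>t\<close>, and
  \<open>x\<close> has no such tokenless customer. The only effect left is that \<open>t\<close>
  must not be held again.\<close>

lemma wt_insert_token:
  "incompat Tc t x \<Longrightarrow> t \<notin> S \<Longrightarrow>
    wt lam Tc (insert t S) x = (if t \<in> set (toks x) then 0 else wt lam Tc S x)"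
proof (induction lam Tc S x rule: wt.induct)
  case (2 lam Tc S c u x)
  then show ?case by (auto simp: insert_commute)
next
  case (3 lam Tc S c x)
  then show ?case by (auto simp: subset_insert)
qed auto

lemma wt_insert_active:
  assumes "incompat Tc t (x @ y)"
  shows "wt lam Tc S (x @ (c, Some t) # y)
    = (if t \<in> S \<union> set (toks (x @ y)) then 0 else wt lam Tc S (x @ y))"
proof (cases "t \<in> S \<union> set (toks x)")
  case False
  then have "wt lam Tc (insert t (S \<union> set (toks x))) y
      = (if t \<in> set (toks y) then 0 else wt lam Tc (S \<union> set (toks x)) y)"
    using assms by (intro wt_insert_token) auto
  then show ?thesis using False by (auto simp: wt_append)
qed (auto simp: wt_append)

text \<open>The two states are those before and after the holder of \<open>t\<close> departs and the
  waiting \<open>c'\<close> takes the token over. Only \<open>y\<close> sees a different set of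
  tokens in front of it, which is harmless by \<open>incompat\<close>; what remains is the factor
  that \<open>c'\<close> contributed while tokenless.\<close>

lemma wt_reassign:
  assumes "incompat Tc t (x @ y)"
  shows "wt lam Tc {} (x @ (c, Some t) # y @ (c', None) # v)
    = (if Tc c' \<subseteq> insert t (set (toks (x @ y))) then lam c' else 0)
      * wt lam Tc {} (x @ y @ (c', Some t) # v)"
proof (cases "t \<in> set (toks x)")
  case False
  then have "wt lam Tc (insert t (set (toks x))) y
      = (if t \<in> set (toks y) then 0 else wt lam Tc (set (toks x)) y)"
    using assms by (intro wt_insert_token) auto
  then show ?thesis using False by (auto simp: wt_append)
qed (auto simp: wt_append)

text \<open>A tokenless \<open>c'\<close> of non-zero weight needs \<open>t\<close> to be held in
  front of it, so a holder of \<open>t\<close> behind it would be a second one.\<close>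

lemma wt_reassign_before:
  assumes "t \<in> Tc c'"
  shows "wt lam Tc {} (x @ (c', None) # y @ (c, Some t) # v) = 0"
  using assms by (auto simp: wt_append)

section \<open>Skeletal functions and their closure properties\<close>

definition insert_at :: "nat \<Rightarrow> 'a \<Rightarrow> 'a list \<Rightarrow> 'a list" where
  "insert_at k e x = take k x @ e # drop k x"

definition skeletal :: "('c \<Rightarrow> real) \<Rightarrow> ('c \<Rightarrow> 't set) \<Rightarrow> (('c, 't) dstate \<Rightarrow> real) \<Rightarrow> bool" where
  "skeletal lam Tc f \<longleftrightarrow> (\<exists>R. \<forall>x. f x = R (sk x) * wt lam Tc {} x)"

lemma skeletalI: "(\<And>x. f x = R (sk x) * wt lam Tc {} x) \<Longrightarrow> skeletal lam Tc f"
  unfolding skeletal_def by blast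

lemma skeletal_mult:
  assumes "skeletal lam Tc f" "\<And>x. h x = H (sk x)"
  shows "skeletal lam Tc (\<lambda>x. h x * f x)"
proof -
  obtain R where "\<And>x. f x = R (sk x) * wt lam Tc {} x"
    using assms(1) unfolding skeletal_def by blast
  then show ?thesis by (intro skeletalI[where R = "\<lambda>m. H m * R m"]) (simp add: assms(2))
qed

lemma skeletal_add:
  assumes "skeletal lam Tc f" "skeletal lam Tc g"
  shows "skeletal lam Tc (\<lambda>x. f x + g x)"
proof -
  obtain R R' where "\<And>x. f x = R (sk x) * wt lam Tc {} x" "\<And>x. g x = R' (sk x) * wt lam Tc {} x"
    using assms unfolding skeletal_def by blast
  then show ?thesis
    by (intro skeletalI[where R = "\<lambda>m. R m + R' m"]) (simp add: algebra_simps)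
qed

lemma skeletal_sum:
  assumes "\<And>i. skeletal lam Tc (f i)" "\<And>x. I x = J (sk x)"
  shows "skeletal lam Tc (\<lambda>x. \<Sum>i\<in>I x. f i x)"
proof -
  obtain R where "\<And>i x. f i x = R i (sk x) * wt lam Tc {} x"
    using assms(1) unfolding skeletal_def by metis
  then show ?thesis
    by (intro skeletalI[where R = "\<lambda>m. \<Sum>i\<in>J m. R i m"]) (simp add: assms(2) sum_distrib_right)
qed

text \<open>At a skeleton whose states all have weight 0 the factors \<open>R n\<close> need not
  converge, but there any value of \<open>lim\<close> will do; elsewhere division by the weight
  forces convergence.\<close>

lemma skeletal_LIMSEQ:
  assumes "\<And>n. skeletal lam Tc (f n)" and lim: "\<And>x. (\<lambda>n. f n x) \<longlonglongrightarrow> g x"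
  shows "skeletal lam Tc g"
proof -
  obtain R where R: "\<And>n x. f n x = R n (sk x) * wt lam Tc {} x"
    using assms(1) unfolding skeletal_def by metis
  show ?thesis
  proof (rule skeletalI[where R = "\<lambda>m. lim (\<lambda>n. R n m)"])
    fix x
    show "g x = lim (\<lambda>n. R n (sk x)) * wt lam Tc {} x"
    proof (cases "wt lam Tc {} x = 0")
      case True
      then have "(\<lambda>n. f n x) \<longlonglongrightarrow> 0" by (simp add: R)
      then show ?thesis using True lim LIMSEQ_unique by fastforce
    next
      case False
      have "(\<lambda>n. f n x / wt lam Tc {} x) \<longlonglongrightarrow> g x / wt lam Tc {} x"
        by (intro tendsto_divide lim tendsto_const False)
      then have "(\<lambda>n. R n (sk x)) \<longlonglongrightarrow> g x / wt lam Tc {} x" using False by (simp add: R)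
      then have "lim (\<lambda>n. R n (sk x)) = g x / wt lam Tc {} x" by (rule limI)
      then show ?thesis using False by simp
    qed
  qed
qed

text \<open>This is the contribution of departures whose token nobody takes: \<open>x\<close> is the
  state afterwards, and the departed customer stood at position \<open>k\<close>.\<close>

lemma skeletal_insert:
  assumes "skeletal lam Tc u"
  shows "skeletal lam Tc (\<lambda>x. if incompat Tc t x then u (insert_at k (c, Some t) x) else 0)"
proof -
  obtain R where R: "\<And>x. u x = R (sk x) * wt lam Tc {} x"
    using assms unfolding skeletal_def by metis
  show ?thesis
  proof (rule skeletalI[where R = "\<lambda>m. if t \<in> set (sk_toks m) then 0 else R (insert_at k (Some (c, t)) m)"])
    fix x
    have "wt lam Tc {} (insert_at k (c, Some t) x) = (if t \<in> set (toks x) then 0 else wt lam Tc {} x)"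
      if "incompat Tc t x"
      using wt_insert_active[of Tc t "take k x" "drop k x" lam "{}" c] that
      by (simp add: insert_at_def)
    \<comment> \<open>\<open>incompat\<close> looks at types that the skeleton forgets. For
      \<open>t\<close> not held in \<open>x\<close>, however, it holds wherever the weight is
      non-zero, so the factor need not test it.\<close>
    moreover have "wt lam Tc {} x = 0" if inc: "\<not> incompat Tc t x" and t: "t \<notin> set (toks x)"
    proof -
      obtain c' y v where "x = y @ (c', None) # v" "t \<in> Tc c'"
        using inc by (rule not_incompatE)
      then show ?thesis using t by (auto simp: wt_append)
    qed
    ultimately show "(if incompat Tc t x then u (insert_at k (c, Some t) x) else 0)
        = (if t \<in> set (sk_toks (sk x)) then 0 else R (insert_at k (Some (c, t)) (sk x))) * wt lam Tc {} x"
      by (auto simp: R toks_eq_sk_toks insert_at_def sk_take sk_drop)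
  qed
qed

text \<open>This is the contribution of departures whose token passes to the customer at position
  \<open>l\<close> of \<open>x\<close>: the predecessor arises by taking that token back and
  inserting the departed holder at position \<open>k\<close>.\<close>

lemma skeletal_reassign:
  fixes u :: "('c, 't) dstate \<Rightarrow> real"
  assumes "skeletal lam Tc u"
  shows "skeletal lam Tc (\<lambda>x.
    if l < length x \<and> k \<le> length x \<and> snd (x ! l) = Some t \<and> t \<in> Tc (fst (x ! l)) \<and> incompat Tc t (take l x)
    then u (insert_at k (c, Some t) (x[l := (fst (x ! l), None)])) else 0)"
proof -
  obtain R where R: "\<And>x. u x = R (sk x) * wt lam Tc {} x"
    using assms unfolding skeletal_def by metis
  \<comment> \<open>\<open>G\<close> is the weight of the customer at \<open>l\<close> while it was
    tokenless. As it now holds \<open>t\<close>, its type can be read off the skeleton.\<close>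
  define G where "G m c' = (if Tc c' \<subseteq> insert t (set (sk_toks (take l m))) then lam c' else 0)"
    for m :: "('c \<times> 't) option list" and c'
  show ?thesis
  \<comment> \<open>The factor tests \<open>k \<le> l\<close> in place of
    \<open>k \<le> length x\<close> and \<open>incompat\<close>: for \<open>k > l\<close> the
    predecessor has weight 0 by \<open>wt_reassign_before\<close>, and a compatible tokenless
    customer in front of \<open>l\<close> gives \<open>x\<close> weight 0.\<close>
  proof (rule skeletalI[where R = "\<lambda>m.
      if l < length m \<and> k \<le> l \<and> (\<exists>c'. m ! l = Some (c', t) \<and> t \<in> Tc c')
      then R (insert_at k (Some (c, t)) (m[l := None])) * G m (fst (the (m ! l))) else 0"])
    fix x
    let ?f = "if l < length x \<and> k \<le> length x \<and> snd (x ! l) = Some t \<and> t \<in> Tc (fst (x ! l)) \<and> incompat Tc t (take l x)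
      then u (insert_at k (c, Some t) (x[l := (fst (x ! l), None)])) else 0"
    let ?R = "if l < length (sk x) \<and> k \<le> l \<and> (\<exists>c'. sk x ! l = Some (c', t) \<and> t \<in> Tc c')
      then R (insert_at k (Some (c, t)) ((sk x)[l := None])) * G (sk x) (fst (the (sk x ! l))) else 0"
    show "?f = ?R * wt lam Tc {} x"
    proof (cases "l < length x \<and> snd (x ! l) = Some t \<and> t \<in> Tc (fst (x ! l))")
      case False
      then have "?R = 0" by (auto simp: sk_def)
      then show ?thesis using False by auto
    next
      case True
      define c' where "c' = fst (x ! l)"
      define a v where "a = take l x" "v = drop (Suc l) x"
      have la: "length a = l" using True by (simp add: a_v_def)
      have xl: "x ! l = (c', Some t)" using True by (simp add: c'_def prod_eq_iff)
      have x: "x = a @ (c', Some t) # v" using True xl a_v_def by (metis id_take_nth_drop)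
      have upd: "x[l := (fst (x ! l), None)] = a @ (c', None) # v"
        using la unfolding xl by (simp add: x list_update_append)
      have tc: "t \<in> Tc c'" using True c'_def by simp
      show ?thesis
      proof (cases "incompat Tc t a")
        case inc: True
        show ?thesis
        proof (cases "k \<le> l")
          case kl: True
          have y: "insert_at k (c, Some t) (a @ (c', None) # v)
              = take k a @ (c, Some t) # drop k a @ (c', None) # v"
            using kl la by (simp add: insert_at_def)
          have app: "take k a @ drop k a @ w = a @ w" for w
            by (metis append_assoc append_take_drop_id)
          have "wt lam Tc {} (insert_at k (c, Some t) (a @ (c', None) # v)) = G (sk x) c' * wt lam Tc {} x"
            unfolding y using inc la
            by (subst wt_reassign) (simp_all add: x G_def toks_eq_sk_toks app)
          moreover have "sk (insert_at k (c, Some t) (a @ (c', None) # v))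
              = insert_at k (Some (c, t)) ((sk x)[l := None])"
            using la kl by (simp add: x y insert_at_def sk_take sk_drop list_update_append)
          moreover have "?R = R (insert_at k (Some (c, t)) ((sk x)[l := None])) * G (sk x) c'"
            using kl la tc by (simp add: x nth_append)
          moreover have "?f = u (insert_at k (c, Some t) (a @ (c', None) # v))"
            using kl inc True by (simp add: upd a_v_def)
          ultimately show ?thesis by (simp add: R)
        next
          case kl: False
          have "insert_at k (c, Some t) (a @ (c', None) # v)
              = a @ (c', None) # take (k - l - 1) v @ (c, Some t) # drop (k - l - 1) v"
            using kl la by (simp add: insert_at_def take_Cons' drop_Cons')
          then have "wt lam Tc {} (insert_at k (c, Some t) (a @ (c', None) # v)) = 0"
            using wt_reassign_before[of t Tc c'] tc by metis
          then show ?thesis using kl by (simp add: R upd)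
        qed
      next
        case inc: False
        then have "wt lam Tc {} x = 0"
        proof -
          obtain b y w where "a = y @ (b, None) # w" "t \<in> Tc b"
            using inc by (rule not_incompatE)
          then show ?thesis by (auto simp: wt_append x)
        qed
        then show ?thesis using inc by (simp add: a_v_def)
      qed
    qed
  qed
qed

section \<open>Inflow into a state\<close>

abbreviation (input) level :: "nat \<Rightarrow> 'a list set" where
  "level n \<equiv> {x. length x = n}"

lemma finite_level [simp]: "finite (level n :: ('c::finite, 't::finite) dstate set)"
  using finite_lists_length_eq[of "UNIV :: ('c \<times> 't option) set" n] by simp

lemma length_insert_at [simp]: "k \<le> length z \<Longrightarrow> length (insert_at k e z) = Suc (length z)"
  by (simp add: insert_at_def)

lemma nth_insert_at [simp]: "k \<le> length z \<Longrightarrow> insert_at k e z ! k = e"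
  by (simp add: insert_at_def nth_append)

lemma remove_insert_at:
  "k \<le> length z \<Longrightarrow> take k (insert_at k e z) @ drop (Suc k) (insert_at k e z) = z"
  by (simp add: insert_at_def)

lemma insert_remove_at:
  "k < length y \<Longrightarrow> insert_at k (y ! k) (take k y @ drop (Suc k) y) = y"
  by (simp add: insert_at_def id_take_nth_drop[symmetric])

section \<open>Passing on the token of a departed customer\<close>

definition reassign :: "('c \<Rightarrow> 't set) \<Rightarrow> 't \<Rightarrow> ('c, 't) dstate \<Rightarrow> ('c, 't) dstate" where
  "reassign Tc t z =
     (if \<exists>l<length z. snd (z ! l) = None \<and> t \<in> Tc (fst (z ! l))
      then (let l = (LEAST l. l < length z \<and> snd (z ! l) = None \<and> t \<in> Tc (fst (z ! l)))
            in z[l := (fst (z ! l), Some t)])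
      else z)"

lemma after_dep_insert_at:
  "k \<le> length z \<Longrightarrow> after_dep Tc (insert_at k (c, Some t) z) k = reassign Tc t z"
  by (simp add: after_dep_def reassign_def remove_insert_at Let_def)

lemma length_after_dep: "k < length x \<Longrightarrow> length (after_dep Tc x k) = length x - 1"
  by (simp add: after_dep_def Let_def)

lemma incompat_nth:
  "incompat Tc t z \<longleftrightarrow> \<not> (\<exists>l<length z. snd (z ! l) = None \<and> t \<in> Tc (fst (z ! l)))"
  unfolding incompat_def all_set_conv_all_nth by blast

text \<open>Minimality of the chosen index is expressed by \<open>incompat\<close> on the prefix
  before \<open>l\<close>, so at most one summand survives. In this form the condition can be
  inverted for each \<open>l\<close> separately.\<close>

lemma reassign_indicator:
  fixes G :: "('c, 't) dstate \<Rightarrow> real"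
  assumes len: "length z = length x"
  shows "(if x = reassign Tc t z then G z else 0) =
     (if incompat Tc t z \<and> x = z then G z else 0) +
     (\<Sum>l<length x. if snd (z ! l) = None \<and> t \<in> Tc (fst (z ! l)) \<and> incompat Tc t (take l z)
          \<and> x = z[l := (fst (z ! l), Some t)] then G z else 0)"
proof (cases "incompat Tc t z")
  case True
  then have "reassign Tc t z = z" unfolding reassign_def incompat_nth by (rule if_not_P)
  moreover have "(\<Sum>l<length x. if snd (z ! l) = None \<and> t \<in> Tc (fst (z ! l)) \<and> incompat Tc t (take l z)
          \<and> x = z[l := (fst (z ! l), Some t)] then G z else 0) = 0"
  proof (intro sum.neutral ballI if_not_P)
    fix l assume "l \<in> {..<length x}"
    then have "\<not> (snd (z ! l) = None \<and> t \<in> Tc (fst (z ! l)))"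
      using True len unfolding incompat_nth by simp
    then show "\<not> (snd (z ! l) = None \<and> t \<in> Tc (fst (z ! l)) \<and> incompat Tc t (take l z)
          \<and> x = z[l := (fst (z ! l), Some t)])" by blast
  qed
  ultimately show ?thesis using True by simp
next
  case False
  let ?P = "\<lambda>l. l < length z \<and> snd (z ! l) = None \<and> t \<in> Tc (fst (z ! l))"
  define m where "m = (LEAST l. ?P l)"
  have ex: "\<exists>l. ?P l" using False unfolding incompat_nth by blast
  have m: "?P m" unfolding m_def using ex by (rule LeastI_ex)
  have first: "(?P l \<and> incompat Tc t (take l z)) \<longleftrightarrow> l = m" for l
  proof
    assume l: "?P l \<and> incompat Tc t (take l z)"
    then have "m \<le> l" unfolding m_def by (intro Least_le) blast
    moreover have "\<not> m < l"
    proof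
      assume "m < l"
      then have "m < length (take l z) \<and> snd (take l z ! m) = None \<and> t \<in> Tc (fst (take l z ! m))"
        using m by simp
      then show False using l unfolding incompat_nth by blast
    qed
    ultimately show "l = m" by simp
  next
    assume "l = m"
    have "\<not> ?P j" if "j < m" for j using that not_less_Least unfolding m_def by blast
    then have "incompat Tc t (take m z)" unfolding incompat_nth by simp
    with m \<open>l = m\<close> show "?P l \<and> incompat Tc t (take l z)" by blast
  qed
  have "reassign Tc t z = z[m := (fst (z ! m), Some t)]"
    unfolding reassign_def m_def Let_def using ex by (intro if_P) blast
  moreover have "(\<Sum>l<length x. if snd (z ! l) = None \<and> t \<in> Tc (fst (z ! l)) \<and> incompat Tc t (take l z)
          \<and> x = z[l := (fst (z ! l), Some t)] then G z else 0)
     = (\<Sum>l<length x. if l = m then (if x = z[m := (fst (z ! m), Some t)] then G z else 0) else 0)"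
  proof (rule sum.cong[OF refl])
    fix l assume "l \<in> {..<length x}"
    then have "(snd (z ! l) = None \<and> t \<in> Tc (fst (z ! l)) \<and> incompat Tc t (take l z)) \<longleftrightarrow> l = m"
      using first[of l] len by simp
    then have "(snd (z ! l) = None \<and> t \<in> Tc (fst (z ! l)) \<and> incompat Tc t (take l z)
          \<and> x = z[l := (fst (z ! l), Some t)]) \<longleftrightarrow> l = m \<and> x = z[m := (fst (z ! m), Some t)]"
      by metis
    then show "(if snd (z ! l) = None \<and> t \<in> Tc (fst (z ! l)) \<and> incompat Tc t (take l z)
          \<and> x = z[l := (fst (z ! l), Some t)] then G z else 0)
       = (if l = m then (if x = z[m := (fst (z ! m), Some t)] then G z else 0) else 0)"
      by (simp only: if_P) simp
  qed
  moreover have "m < length x" using m len by simp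
  ultimately show ?thesis using False by simp
qed

lemma sum_reassign_preimage:
  fixes G :: "('c::finite, 't::finite) dstate \<Rightarrow> real"
  shows "(\<Sum>z\<in>level (length x). if x = reassign Tc t z then G z else 0) =
     (if incompat Tc t x then G x else 0) +
     (\<Sum>l<length x. if snd (x ! l) = Some t \<and> t \<in> Tc (fst (x ! l)) \<and> incompat Tc t (take l x)
        then G (x[l := (fst (x ! l), None)]) else 0)"
proof -
  have "(\<Sum>z\<in>level (length x). if x = reassign Tc t z then G z else 0) =
     (\<Sum>z\<in>level (length x). (if incompat Tc t z \<and> x = z then G z else 0)) +
     (\<Sum>z\<in>level (length x). \<Sum>l<length x. if snd (z ! l) = None \<and> t \<in> Tc (fst (z ! l)) \<and> incompat Tc t (take l z)
          \<and> x = z[l := (fst (z ! l), Some t)] then G z else 0)"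
    by (simp add: reassign_indicator sum.distrib)
  also have "(\<Sum>z\<in>level (length x). (if incompat Tc t z \<and> x = z then G z else 0))
      = (\<Sum>z\<in>level (length x). (if x = z then (if incompat Tc t x then G x else 0) else 0))"
    by (intro sum.cong) auto
  also have "\<dots> = (if incompat Tc t x then G x else 0)" by simp
  also have "(\<Sum>z\<in>level (length x). \<Sum>l<length x. if snd (z ! l) = None \<and> t \<in> Tc (fst (z ! l)) \<and> incompat Tc t (take l z)
          \<and> x = z[l := (fst (z ! l), Some t)] then G z else 0)
     = (\<Sum>l<length x. \<Sum>z\<in>level (length x). if snd (z ! l) = None \<and> t \<in> Tc (fst (z ! l)) \<and> incompat Tc t (take l z)
          \<and> x = z[l := (fst (z ! l), Some t)] then G z else 0)"
    by (rule sum.swap)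
  also have "\<dots> = (\<Sum>l<length x. if snd (x ! l) = Some t \<and> t \<in> Tc (fst (x ! l)) \<and> incompat Tc t (take l x)
        then G (x[l := (fst (x ! l), None)]) else 0)"
  proof (rule sum.cong[OF refl])
    fix l assume l: "l \<in> {..<length x}"
    let ?C = "snd (x ! l) = Some t \<and> t \<in> Tc (fst (x ! l)) \<and> incompat Tc t (take l x)"
    let ?z = "x[l := (fst (x ! l), None)]"
    have "(\<Sum>z\<in>level (length x). if snd (z ! l) = None \<and> t \<in> Tc (fst (z ! l)) \<and> incompat Tc t (take l z)
          \<and> x = z[l := (fst (z ! l), Some t)] then G z else 0)
      = (\<Sum>z\<in>level (length x). if z = ?z then (if ?C then G ?z else 0) else 0)"
    proof (rule sum.cong[OF refl])
      fix z :: "('c, 't) dstate" assume z: "z \<in> level (length x)"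
      \<comment> \<open>For fixed \<open>l\<close> the inverse takes the token away from position
        \<open>l\<close>; the prefix condition carries over because \<open>z\<close> and
        \<open>x\<close> agree before \<open>l\<close>.\<close>
      have "(snd (z ! l) = None \<and> t \<in> Tc (fst (z ! l)) \<and> incompat Tc t (take l z)
          \<and> x = z[l := (fst (z ! l), Some t)]) \<longleftrightarrow> z = ?z \<and> ?C" (is "?L \<longleftrightarrow> ?R")
      proof
        assume L: ?L
        then have x: "x = z[l := (fst (z ! l), Some t)]" by blast
        have e: "(fst (z ! l), None) = z ! l" using L by (simp add: prod_eq_iff)
        have "?z = z" using l z unfolding x by (simp add: e)
        moreover have ?C using L l z by (subst (1 2 3) x) (simp add: incompat_def)
        ultimately show ?R by simp
      next
        assume R: ?R
        then have zz: "z = ?z" by blast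
        have e: "(fst (x ! l), Some t) = x ! l" using R by (simp add: prod_eq_iff)
        show ?L using l R by (subst (1 2 3 4 5) zz) (simp add: e)
      qed
      then show "(if snd (z ! l) = None \<and> t \<in> Tc (fst (z ! l)) \<and> incompat Tc t (take l z)
          \<and> x = z[l := (fst (z ! l), Some t)] then G z else 0)
        = (if z = ?z then (if ?C then G ?z else 0) else 0)" by auto
    qed
    also have "\<dots> = (if ?C then G ?z else 0)" by (subst sum.delta) auto
    finally show "(\<Sum>z\<in>level (length x). if snd (z ! l) = None \<and> t \<in> Tc (fst (z ! l)) \<and> incompat Tc t (take l z)
          \<and> x = z[l := (fst (z ! l), Some t)] then G z else 0) = (if ?C then G ?z else 0)" .
  qed
  finally show ?thesis .
qed

lemma sum_active_at:
  fixes H :: "('c::finite, 't::finite) dstate \<Rightarrow> real"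
  assumes "k \<le> n"
  shows "(\<Sum>y\<in>level (Suc n). if active (y ! k) then H y else 0)
    = (\<Sum>c\<in>UNIV. \<Sum>t\<in>UNIV. \<Sum>z\<in>level n. H (insert_at k (c, Some t) z))"
proof -
  have "(\<Sum>y\<in>level (Suc n). if active (y ! k) then H y else 0)
      = (\<Sum>y\<in>{y. length y = Suc n \<and> active (y ! k)}. H y)"
    by (rule sum.mono_neutral_cong_right) auto
  also have "\<dots> = (\<Sum>(c, t, z)\<in>UNIV \<times> UNIV \<times> level n. H (insert_at k (c, Some t) z))"
    by (rule sum.reindex_bij_witness[where
        i = "\<lambda>(c, t, z). insert_at k (c, Some t) z" and
        j = "\<lambda>y. (fst (y ! k), the (snd (y ! k)), take k y @ drop (Suc k) y)"])
      (use assms in \<open>auto simp: active_def remove_insert_at insert_remove_at\<close>)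
  also have "\<dots> = (\<Sum>c\<in>UNIV. \<Sum>t\<in>UNIV. \<Sum>z\<in>level n. H (insert_at k (c, Some t) z))"
    by (simp add: sum.cartesian_product)
  finally show ?thesis .
qed

section \<open>Arrival and departure parts of the generator\<close>

locale token_queue =
  fixes lam :: "'c::finite \<Rightarrow> real"
    and Tc :: "'c \<Rightarrow> 't::finite set"
    and assign :: "'c \<Rightarrow> 't set \<Rightarrow> 't \<Rightarrow> real"
    and s :: "'t list \<Rightarrow> real"
    and eta :: "nat \<Rightarrow> real"
  assumes lam_pos: "lam c > 0"
    and Tc_ne: "Tc c \<noteq> {}"
    and assign_nonneg: "assign c R t \<ge> 0"
    and assign_supp: "t \<notin> Tc c - R \<Longrightarrow> assign c R t = 0"
    and assign_sum: "Tc c - R \<noteq> {} \<Longrightarrow> (\<Sum>t\<in>UNIV. assign c R t) = 1"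
    and s_nonneg: "s ts \<ge> 0"
    and k_pos: "distinct ts \<Longrightarrow> ts \<noteq> [] \<Longrightarrow> kf s ts > 0"
    and eta_pos: "eta m > 0"
begin

abbreviation w :: "('c, 't) dstate \<Rightarrow> real" where
  "w \<equiv> wt lam Tc {}"

definition q_arr :: "('c, 't) dstate \<Rightarrow> ('c, 't) dstate \<Rightarrow> real" where
  "q_arr x y = (\<Sum>c\<in>UNIV.
        if Tc c - set (toks x) \<noteq> {}
        then (\<Sum>t\<in>UNIV. lam c * assign c (set (toks x)) t * (if y = x @ [(c, Some t)] then 1 else 0))
        else lam c * (if y = x @ [(c, None)] then 1 else 0))"

definition q_dep :: "('c, 't) dstate \<Rightarrow> ('c, 't) dstate \<Rightarrow> real" where
  "q_dep x y = (\<Sum>k<length x. if active (x ! k) \<and> y = after_dep Tc x k then dep_rate s eta x k else 0)"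

lemma qrate_split: "qrate lam Tc assign s eta x y = q_arr x y + q_dep x y"
  by (simp add: qrate_def q_arr_def q_dep_def)

lemma dep_rate_nonneg: "dep_rate s eta x k \<ge> 0"
  using eta_pos[of "length x"] s_nonneg by (simp add: dep_rate_def)

lemma q_arr_nonneg: "q_arr x y \<ge> 0"
  unfolding q_arr_def
  using lam_pos assign_nonneg by (intro sum_nonneg) (auto intro!: sum_nonneg simp: less_imp_le)

lemma q_dep_nonneg: "q_dep x y \<ge> 0"
  unfolding q_dep_def by (intro sum_nonneg) (auto simp: dep_rate_nonneg)

lemma q_arr_Some:
  "q_arr x (x @ [(c, Some t)])
    = (if Tc c - set (toks x) \<noteq> {} then lam c * assign c (set (toks x)) t else 0)"
proof -
  have "q_arr x (x @ [(c, Some t)]) =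
    (\<Sum>c'\<in>UNIV. if c' = c then (if Tc c - set (toks x) \<noteq> {} then lam c * assign c (set (toks x)) t else 0) else 0)"
    unfolding q_arr_def
  proof (rule sum.cong[OF refl])
    fix c' :: 'c
    have "(\<Sum>t'\<in>UNIV. lam c * assign c (set (toks x)) t' * (if t' = t then 1 else 0))
      = lam c * assign c (set (toks x)) t"
      by (simp add: if_distrib cong: if_cong)
    then show "(if Tc c' - set (toks x) \<noteq> {}
        then (\<Sum>t'\<in>UNIV. lam c' * assign c' (set (toks x)) t' * (if x @ [(c, Some t)] = x @ [(c', Some t')] then 1 else 0))
        else lam c' * (if x @ [(c, Some t)] = x @ [(c', None)] then 1 else 0))
      = (if c' = c then (if Tc c - set (toks x) \<noteq> {} then lam c * assign c (set (toks x)) t else 0) else 0)"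
      by (auto simp: eq_commute[of t])
  qed
  then show ?thesis by simp
qed

lemma q_arr_None:
  "q_arr x (x @ [(c, None)]) = (if Tc c \<subseteq> set (toks x) then lam c else 0)"
proof -
  have "q_arr x (x @ [(c, None)]) =
    (\<Sum>c'\<in>UNIV. if c' = c then (if Tc c \<subseteq> set (toks x) then lam c else 0) else 0)"
    unfolding q_arr_def by (rule sum.cong[OF refl]) auto
  then show ?thesis by simp
qed

lemma q_arr_eq_0:
  assumes "x = [] \<or> y \<noteq> butlast x"
  shows "q_arr y x = 0"
proof -
  have "(x = y @ [e]) = False" for e using assms by auto
  then show ?thesis
    by (simp only: q_arr_def if_False mult_zero_right sum.neutral_const if_cancel)
qed

lemma q_dep_eq_0: "length y \<noteq> Suc (length x) \<Longrightarrow> q_dep y x = 0"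
  unfolding q_dep_def by (intro sum.neutral) (auto simp: length_after_dep)

definition in_arr :: "(('c, 't) dstate \<Rightarrow> real) \<Rightarrow> ('c, 't) dstate \<Rightarrow> real" where
  "in_arr u x = (if x = [] then 0 else u (butlast x) * q_arr (butlast x) x)"

definition in_dep :: "(('c, 't) dstate \<Rightarrow> real) \<Rightarrow> ('c, 't) dstate \<Rightarrow> real" where
  "in_dep u x = (\<Sum>y\<in>level (Suc (length x)). u y * q_dep y x)"

text \<open>Arrivals lead to \<open>x\<close> only from \<open>butlast x\<close>, departures only
  from the finitely many states with one more customer, so the infinite sum in the balance equations
  is a finite one.\<close>

lemma infsum_inflow:
  "(\<Sum>\<^sub>\<infinity>y. u y * qrate lam Tc assign s eta y x) = in_arr u x + in_dep u x"
proof -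
  let ?F = "{butlast x} \<union> level (Suc (length x))"
  have nin: "butlast x \<notin> level (Suc (length x))" by simp
  have "(\<Sum>\<^sub>\<infinity>y. u y * qrate lam Tc assign s eta y x) = (\<Sum>\<^sub>\<infinity>y\<in>?F. u y * qrate lam Tc assign s eta y x)"
    by (rule infsum_cong_neutral) (auto simp: qrate_split q_arr_eq_0 q_dep_eq_0)
  also have "\<dots> = (\<Sum>y\<in>?F. u y * qrate lam Tc assign s eta y x)" by (rule infsum_finite) simp
  also have "\<dots> = u (butlast x) * qrate lam Tc assign s eta (butlast x) x
      + (\<Sum>y\<in>level (Suc (length x)). u y * qrate lam Tc assign s eta y x)"
    using nin by simp
  also have "u (butlast x) * qrate lam Tc assign s eta (butlast x) x = in_arr u x"
    by (simp add: qrate_split in_arr_def q_dep_eq_0 q_arr_eq_0)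
  also have "(\<Sum>y\<in>level (Suc (length x)). u y * qrate lam Tc assign s eta y x) = in_dep u x"
    unfolding in_dep_def
  proof (rule sum.cong[OF refl])
    fix y :: "('c, 't) dstate" assume "y \<in> level (Suc (length x))"
    then have "q_arr y x = 0" using nin by (intro q_arr_eq_0) blast
    then show "u y * qrate lam Tc assign s eta y x = u y * q_dep y x" by (simp add: qrate_split)
  qed
  finally show ?thesis .
qed

text \<open>The rate of a tokenless arrival is exactly the factor that the new entry adds to the
  weight, hence the value 1 of \<open>A\<close> at \<open>None\<close>; the rate of an active
  arrival depends on the skeleton only.\<close>

lemma skeletal_in_arr:
  assumes "skeletal lam Tc u"
  shows "skeletal lam Tc (in_arr u)"
proof -
  obtain R where R: "\<And>x. u x = R (sk x) * w x"
    using assms unfolding skeletal_def by metis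
  define A where "A m e = (case e of None \<Rightarrow> 1 | Some (c, t) \<Rightarrow>
      if Tc c - set (sk_toks m) \<noteq> {} then lam c * assign c (set (sk_toks m)) t else 0)"
    for m :: "('c \<times> 't) option list" and e
  show ?thesis
  proof (rule skeletalI[where R = "\<lambda>m. if m = [] then 0 else R (butlast m) * A (butlast m) (last m)"])
    fix x :: "('c, 't) dstate"
    show "in_arr u x = (if sk x = [] then 0 else R (butlast (sk x)) * A (butlast (sk x)) (last (sk x))) * w x"
    proof (cases x rule: rev_cases)
      case (snoc y e)
      obtain c h where e: "e = (c, h)" by (cases e)
      show ?thesis
      proof (cases h)
        case None
        then show ?thesis
          by (simp add: in_arr_def snoc e q_arr_None R A_def wt_append)
      next
        case (Some t)
        \<comment> \<open>If \<open>t\<close> is already held in \<open>y\<close>, the weight on the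
          right is 0, and \<open>assign_supp\<close> makes the rate on the left 0.\<close>
        then show ?thesis
          using assign_supp[of t c "set (toks y)"]
          by (simp add: in_arr_def snoc e q_arr_Some R A_def wt_append toks_eq_sk_toks)
      qed
    qed (simp add: in_arr_def)
  qed
qed

text \<open>Predecessors are sorted by the position \<open>k\<close>, type \<open>c\<close> and
  token \<open>t\<close> of the departed customer; the state left after its removal is a preimage of
  \<open>x\<close> under \<open>reassign Tc t\<close>.\<close>

lemma in_dep_expand:
  "in_dep u x = (\<Sum>k\<le>length x. \<Sum>c\<in>UNIV. \<Sum>t\<in>UNIV.
     (if incompat Tc t x then u (insert_at k (c, Some t) x) * dep_rate s eta (insert_at k (c, Some t) x) k else 0)
     + (\<Sum>l<length x. if snd (x ! l) = Some t \<and> t \<in> Tc (fst (x ! l)) \<and> incompat Tc t (take l x)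
        then u (insert_at k (c, Some t) (x[l := (fst (x ! l), None)]))
          * dep_rate s eta (insert_at k (c, Some t) (x[l := (fst (x ! l), None)])) k else 0))"
proof -
  let ?n = "length x"
  have "in_dep u x = (\<Sum>y\<in>level (Suc ?n). \<Sum>k\<le>?n.
      if active (y ! k) then (if x = after_dep Tc y k then u y * dep_rate s eta y k else 0) else 0)"
    unfolding in_dep_def q_dep_def
    by (intro sum.cong refl) (auto simp: sum_distrib_left lessThan_Suc_atMost intro!: sum.cong)
  also have "\<dots> = (\<Sum>k\<le>?n. \<Sum>y\<in>level (Suc ?n).
      if active (y ! k) then (if x = after_dep Tc y k then u y * dep_rate s eta y k else 0) else 0)"
    by (rule sum.swap)
  also have "\<dots> = (\<Sum>k\<le>?n. \<Sum>c\<in>UNIV. \<Sum>t\<in>UNIV. \<Sum>z\<in>level ?n.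
      if x = reassign Tc t z then u (insert_at k (c, Some t) z) * dep_rate s eta (insert_at k (c, Some t) z) k else 0)"
    by (intro sum.cong refl) (auto simp: sum_active_at after_dep_insert_at intro!: sum.cong)
  finally show ?thesis by (simp only: sum_reassign_preimage)
qed

lemma skeletal_in_dep:
  assumes "skeletal lam Tc u"
  shows "skeletal lam Tc (in_dep u)"
proof -
  \<comment> \<open>Departure rates see only the tokens and the number of customers, so the rate
    times \<open>u\<close> is skeletal and replaces \<open>u\<close> in the insertion
    lemmas.\<close>
  have rate: "skeletal lam Tc (\<lambda>x. dep_rate s eta x k * u x)" for k
    by (rule skeletal_mult[OF assms, where H = "\<lambda>m. eta (length m) * s (sk_toks (take (Suc k) m))"])
      (simp add: dep_rate_def toks_eq_sk_toks sk_take)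
  \<comment> \<open>The tests \<open>l < length x\<close> and \<open>k \<le> length x\<close>,
    automatic in the index ranges, are added to match \<open>skeletal_reassign\<close>.\<close>
  have "skeletal lam Tc (\<lambda>x. \<Sum>k\<in>{..length x}. \<Sum>c\<in>UNIV. \<Sum>t\<in>UNIV.
     (if incompat Tc t x then dep_rate s eta (insert_at k (c, Some t) x) k * u (insert_at k (c, Some t) x) else 0)
     + (\<Sum>l\<in>{..<length x}. if l < length x \<and> k \<le> length x \<and> snd (x ! l) = Some t \<and> t \<in> Tc (fst (x ! l)) \<and> incompat Tc t (take l x)
        then dep_rate s eta (insert_at k (c, Some t) (x[l := (fst (x ! l), None)])) k
           * u (insert_at k (c, Some t) (x[l := (fst (x ! l), None)])) else 0))"
    by (intro skeletal_sum[where I = "\<lambda>x. {..length x}" and J = "\<lambda>m. {..length m}"]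
        skeletal_sum[where I = "\<lambda>x. UNIV" and J = "\<lambda>m. UNIV"]
        skeletal_sum[where I = "\<lambda>x. {..<length x}" and J = "\<lambda>m. {..<length m}"]
        skeletal_add skeletal_insert[OF rate] skeletal_reassign[OF rate]) simp_all
  also have "(\<lambda>x. \<Sum>k\<in>{..length x}. \<Sum>c\<in>UNIV. \<Sum>t\<in>UNIV.
     (if incompat Tc t x then dep_rate s eta (insert_at k (c, Some t) x) k * u (insert_at k (c, Some t) x) else 0)
     + (\<Sum>l\<in>{..<length x}. if l < length x \<and> k \<le> length x \<and> snd (x ! l) = Some t \<and> t \<in> Tc (fst (x ! l)) \<and> incompat Tc t (take l x)
        then dep_rate s eta (insert_at k (c, Some t) (x[l := (fst (x ! l), None)])) k
           * u (insert_at k (c, Some t) (x[l := (fst (x ! l), None)])) else 0)) = in_dep u"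
    unfolding in_dep_expand
    by (rule ext, intro sum.cong arg_cong2[where f = "(+)"] refl if_cong) (auto simp: mult.commute)
  finally show ?thesis .
qed

end

section \<open>The stationary distribution is skeletal\<close>

lemma kf_snoc: "kf s (ts @ [t]) = kf s ts + s (ts @ [t])"
proof -
  have "kf s (ts @ [t]) = (\<Sum>j=1..length ts. s (take j (ts @ [t]))) + s (ts @ [t])"
    by (simp add: kf_def)
  also have "(\<Sum>j=1..length ts. s (take j (ts @ [t]))) = kf s ts"
    unfolding kf_def by (intro sum.cong) auto
  finally show ?thesis .
qed

lemma sum_active_kf:
  "(\<Sum>k<length x. if active (x ! k) then s (toks (take (Suc k) x)) else 0) = kf s (toks x)"
proof (induction x rule: rev_induct)
  case (snoc e x)
  have "(\<Sum>k<length (x @ [e]). if active ((x @ [e]) ! k) then s (toks (take (Suc k) (x @ [e]))) else 0)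
     = (\<Sum>k<length x. if active (x ! k) then s (toks (take (Suc k) x)) else 0)
       + (if active e then s (toks (x @ [e])) else 0)"
    by (simp add: nth_append cong: if_cong sum.cong_simp)
  also have "\<dots> = kf s (toks (x @ [e]))"
    unfolding snoc.IH by (cases e; cases "snd e") (auto simp: active_def kf_snoc)
  finally show ?case .
qed (simp add: kf_def)

context token_queue
begin

abbreviation Lam :: real where
  "Lam \<equiv> \<Sum>c\<in>UNIV. lam c"

definition dep_total :: "('c, 't) dstate \<Rightarrow> real" where
  "dep_total x = eta (length x) * kf s (toks x)"

definition inflow :: "(('c, 't) dstate \<Rightarrow> real) \<Rightarrow> ('c, 't) dstate \<Rightarrow> real" where
  "inflow u x = in_arr u x + in_dep u x"

abbreviation out :: "('c, 't) dstate \<Rightarrow> real" where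
  "out \<equiv> outrate lam s eta"

lemma sum_dep_rate:
  "(\<Sum>k<length x. if active (x ! k) then dep_rate s eta x k else 0) = dep_total x"
  unfolding dep_total_def sum_active_kf[symmetric] dep_rate_def sum_distrib_left
  by (intro sum.cong) auto

lemma out_eq: "out x = Lam + dep_total x"
  by (simp add: outrate_def sum_dep_rate)

lemma Lam_pos: "Lam > 0"
  by (intro sum_pos) (auto simp: lam_pos)

lemma dep_total_nonneg: "dep_total x \<ge> 0"
  unfolding dep_total_def kf_def using eta_pos s_nonneg
  by (intro mult_nonneg_nonneg sum_nonneg) (auto simp: less_imp_le)

lemma out_pos: "out x > 0"
  using Lam_pos dep_total_nonneg[of x] by (simp add: out_eq)

section \<open>Flow between the levels of equal customer number\<close>

lemma sum_q_arr:
  assumes "length y = n"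
  shows "(\<Sum>x\<in>level (Suc n). q_arr y x) = Lam"
proof -
  have one: "(\<Sum>x\<in>level (Suc n). if x = y @ [e] then 1 else 0 :: real) = 1" for e
    using assms by (subst sum.delta) auto
  have *: "(\<Sum>x\<in>level (Suc n). r * (if x = y @ [e] then 1 else 0)) = r" for e and r :: real
    by (simp only: sum_distrib_left[symmetric] one mult_1_right)
  have "(\<Sum>x\<in>level (Suc n). if Tc c - set (toks y) \<noteq> {}
        then (\<Sum>t\<in>UNIV. lam c * assign c (set (toks y)) t * (if x = y @ [(c, Some t)] then 1 else 0))
        else lam c * (if x = y @ [(c, None)] then 1 else 0)) = lam c" for c
  proof (cases "Tc c - set (toks y) \<noteq> {}")
    case True
    have "(\<Sum>x\<in>level (Suc n). \<Sum>t\<in>UNIV. lam c * assign c (set (toks y)) t * (if x = y @ [(c, Some t)] then 1 else 0))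
      = (\<Sum>t\<in>UNIV. lam c * assign c (set (toks y)) t)"
      by (subst sum.swap) (simp only: *)
    also have "\<dots> = lam c" using assign_sum[OF True] by (simp add: sum_distrib_left[symmetric])
    finally show ?thesis using True by simp
  next
    case False
    then show ?thesis by (simp only: if_False *)
  qed
  then show ?thesis
    unfolding q_arr_def by (subst sum.swap) (simp only: )
qed

lemma sum_q_dep:
  assumes "length y = Suc n"
  shows "(\<Sum>x\<in>level n. q_dep y x) = dep_total y"
proof -
  have "(\<Sum>x\<in>level n. if active (y ! k) \<and> x = after_dep Tc y k then dep_rate s eta y k else 0)
     = (if active (y ! k) then dep_rate s eta y k else 0)" if "k < length y" for k
  proof -
    have "(\<Sum>x\<in>level n. if active (y ! k) \<and> x = after_dep Tc y k then dep_rate s eta y k else 0)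
       = (\<Sum>x\<in>level n. if x = after_dep Tc y k then (if active (y ! k) then dep_rate s eta y k else 0) else 0)"
      by (intro sum.cong) auto
    also have "\<dots> = (if active (y ! k) then dep_rate s eta y k else 0)"
      using that assms by (subst sum.delta) (auto simp: length_after_dep)
    finally show ?thesis .
  qed
  then show ?thesis
    unfolding q_dep_def by (subst sum.swap) (simp add: sum_dep_rate)
qed

text \<open>Every arrival raises the number of customers by one, whether or not it claims a token,
  so each state sends up flow at total rate \<open>Lam\<close>.\<close>

lemma sum_in_arr: "(\<Sum>x\<in>level (Suc n). in_arr f x) = Lam * (\<Sum>y\<in>level n. f y)"
proof -
  have "in_arr f x = (\<Sum>y\<in>level n. f y * q_arr y x)" if "x \<in> level (Suc n)" for x
  proof -
    have "(\<Sum>y\<in>level n. f y * q_arr y x) = (\<Sum>y\<in>level n. if y = butlast x then f (butlast x) * q_arr (butlast x) x else 0)"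
      by (intro sum.cong) (auto simp: q_arr_eq_0)
    also have "\<dots> = in_arr f x" using that by (subst sum.delta) (auto simp: in_arr_def)
    finally show ?thesis ..
  qed
  then have "(\<Sum>x\<in>level (Suc n). in_arr f x) = (\<Sum>x\<in>level (Suc n). \<Sum>y\<in>level n. f y * q_arr y x)"
    by (rule sum.cong[OF refl])
  also have "\<dots> = (\<Sum>y\<in>level n. f y * (\<Sum>x\<in>level (Suc n). q_arr y x))"
    unfolding sum_distrib_left by (rule sum.swap)
  also have "\<dots> = (\<Sum>y\<in>level n. f y * Lam)"
    by (intro sum.cong) (auto simp: sum_q_arr)
  finally show ?thesis by (simp add: sum_distrib_left mult.commute)
qed

lemma sum_in_dep: "(\<Sum>x\<in>level n. in_dep f x) = (\<Sum>y\<in>level (Suc n). f y * dep_total y)"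
proof -
  have "(\<Sum>x\<in>level n. in_dep f x) = (\<Sum>x\<in>level n. \<Sum>y\<in>level (Suc n). f y * q_dep y x)"
    by (intro sum.cong) (auto simp: in_dep_def)
  also have "\<dots> = (\<Sum>y\<in>level (Suc n). f y * (\<Sum>x\<in>level n. q_dep y x))"
    unfolding sum_distrib_left by (rule sum.swap)
  also have "\<dots> = (\<Sum>y\<in>level (Suc n). f y * dep_total y)"
    by (intro sum.cong) (auto simp: sum_q_dep)
  finally show ?thesis .
qed

section \<open>Monotonicity and support of the inflow\<close>

lemma inflow_mono:
  assumes "\<And>x. u x \<le> v x"
  shows "inflow u x \<le> inflow v x"
  unfolding inflow_def in_arr_def in_dep_def
  by (intro add_mono sum_mono) (auto intro!: mult_right_mono assms simp: q_arr_nonneg q_dep_nonneg)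

lemma skeletal_inflow: "skeletal lam Tc u \<Longrightarrow> skeletal lam Tc (inflow u)"
  unfolding inflow_def[abs_def] by (intro skeletal_add skeletal_in_arr skeletal_in_dep)

lemma w_nonneg: "w x \<ge> 0"
  by (intro wt_nonneg less_imp_le lam_pos)

lemma in_arr_nonneg: "(\<And>x. u x \<ge> 0) \<Longrightarrow> in_arr u x \<ge> 0"
  by (simp add: in_arr_def q_arr_nonneg)

lemma in_dep_nonneg: "(\<And>x. u x \<ge> 0) \<Longrightarrow> in_dep u x \<ge> 0"
  by (simp add: in_dep_def q_dep_nonneg sum_nonneg)

text \<open>Since \<^term>\<open>w\<close> is itself skeletal, so is its inflow; hence no transition leaves the support of \<^term>\<open>w\<close>.\<close>

lemma w_step:
  assumes "w x \<noteq> 0" "qrate lam Tc assign s eta x y > 0"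
  shows "w y \<noteq> 0"
proof -
  have "w x > 0" using assms(1) w_nonneg[of x] by simp
  have "skeletal lam Tc w" by (rule skeletalI[where R = "\<lambda>_. 1"]) simp
  then obtain R where R: "\<And>y. inflow w y = R (sk y) * w y"
    using skeletal_inflow unfolding skeletal_def by blast
  have pos: "in_arr w y \<ge> 0" "in_dep w y \<ge> 0"
    by (simp_all add: in_arr_nonneg in_dep_nonneg w_nonneg)
  consider "q_arr x y > 0" | "q_dep x y > 0"
    using assms(2) q_arr_nonneg[of x y] q_dep_nonneg[of x y] unfolding qrate_split by linarith
  then have "inflow w y > 0"
  proof cases
    case 1
    then have "x = butlast y" "y \<noteq> []" using q_arr_eq_0 by (metis less_irrefl)+
    then have "in_arr w y > 0" using 1 \<open>w x > 0\<close> by (simp add: in_arr_def)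
    then show ?thesis using pos by (simp add: inflow_def)
  next
    case 2
    then have "x \<in> level (Suc (length y))" using q_dep_eq_0[of x y] by auto
    then have "w x * q_dep x y \<le> in_dep w y"
      unfolding in_dep_def
      by (intro member_le_sum) (auto simp: w_nonneg q_dep_nonneg)
    moreover have "w x * q_dep x y > 0" using 2 \<open>w x > 0\<close> by simp
    ultimately show ?thesis using pos by (simp add: inflow_def)
  qed
  then show ?thesis using R by auto
qed

lemma w_reachable: "(\<lambda>u v. qrate lam Tc assign s eta u v > 0)\<^sup>*\<^sup>* [] x \<Longrightarrow> w x \<noteq> 0"
  by (induction rule: rtranclp_induct) (auto dest: w_step)

text \<open>In the support of \<open>w\<close> the first customer is active: no token is held in
  front of it, while its set \<open>Tc c\<close> is nonempty.\<close>

lemma dep_total_pos: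
  assumes "w x \<noteq> 0" "x \<noteq> []"
  shows "dep_total x > 0"
proof -
  obtain c h y where x: "x = (c, h) # y" using assms(2) by (cases x) auto
  have "h \<noteq> None" using assms(1) Tc_ne[of c] by (cases h) (auto simp: x split: if_splits)
  then have "toks x \<noteq> []" by (auto simp: x)
  moreover have "distinct (toks x)" using wt_distinct[OF assms(1)] by simp
  ultimately show ?thesis using k_pos eta_pos by (simp add: dep_total_def)
qed

end

section \<open>Level flows of the stationary distribution and its monotone approximation\<close>

locale stationary_token_queue = token_queue lam Tc assign s eta
  for lam :: "'c::finite \<Rightarrow> real"
    and Tc :: "'c \<Rightarrow> 't::finite set"
    and assign s eta +
  fixes p :: "('c, 't) dstate \<Rightarrow> real"
  assumes stat: "stationary lam Tc assign s eta p"
begin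

lemma p_nonneg: "p x \<ge> 0"
  and p_has_sum: "(p has_sum 1) UNIV"
  and p_balance: "inflow p x = p x * out x"
  using stat unfolding stationary_def infsum_inflow inflow_def by auto

lemma p_support: "p x \<noteq> 0 \<Longrightarrow> w x \<noteq> 0"
  using stat w_reachable unfolding stationary_def by blast

lemma level_sums_tendsto_0: "(\<lambda>n. \<Sum>x\<in>level n. p x) \<longlonglongrightarrow> 0"
proof (rule summable_LIMSEQ_zero, rule summableI_nonneg_bounded)
  fix n
  show "0 \<le> (\<Sum>x\<in>level n. p x)" by (simp add: sum_nonneg p_nonneg)
  have "(\<Sum>i<n. \<Sum>x\<in>level i. p x) = (\<Sum>x\<in>(\<Union>i<n. level i). p x)"
    by (subst sum.UNION_disjoint) auto
  also have "\<dots> \<le> infsum p UNIV"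
    using p_has_sum by (intro finite_sum_le_infsum) (auto simp: p_nonneg has_sum_imp_summable)
  also have "\<dots> = 1" using p_has_sum by (rule infsumI)
  finally show "(\<Sum>i<n. \<Sum>x\<in>level i. p x) \<le> 1" .
qed

text \<open>Summing the balance equations over level \<open>Suc n\<close> equates the net flow
  through the cut above this level with that through the cut below it.\<close>

lemma level_flow_step:
  assumes "\<And>x. x \<in> level (Suc n) \<Longrightarrow> inflow f x = f x * out x"
  shows "(\<Sum>y\<in>level (Suc (Suc n)). f y * dep_total y) - Lam * (\<Sum>y\<in>level (Suc n). f y)
    = (\<Sum>y\<in>level (Suc n). f y * dep_total y) - Lam * (\<Sum>y\<in>level n. f y)"
proof -
  have "(\<Sum>x\<in>level (Suc n). inflow f x) = (\<Sum>x\<in>level (Suc n). f x * Lam + f x * dep_total x)"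
    using assms by (intro sum.cong) (auto simp: out_eq algebra_simps)
  then show ?thesis
    by (simp add: inflow_def sum.distrib sum_in_arr sum_in_dep sum_distrib_left mult.commute)
qed

text \<open>Balance at the empty state makes the net flow through the lowest cut 0, and hence
  through every cut. So the downward flow of \<open>p\<close> tends to 0 together with the level
  sums, without any bound on \<open>eta\<close>.\<close>

lemma p_level_flow:
  "(\<Sum>y\<in>level (Suc n). p y * dep_total y) = Lam * (\<Sum>y\<in>level n. p y)"
proof (induction n)
  case 0
  have "in_dep p [] = (\<Sum>y\<in>level (Suc 0). p y * dep_total y)"
    using sum_in_dep[of p 0] by simp
  moreover have "dep_total [] = 0" by (simp add: dep_total_def kf_def)
  ultimately show ?case using p_balance[of "[]"] by (simp add: inflow_def in_arr_def out_eq)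
next
  case (Suc n)
  then show ?case using level_flow_step[of n p] p_balance by simp
qed

text \<open>The monotone iteration below sums over the excursions of the process from the empty state.\<close>

primrec iter :: "nat \<Rightarrow> ('c, 't) dstate \<Rightarrow> real" where
  "iter 0 = (\<lambda>x. 0)"
| "iter (Suc n) = (\<lambda>x. if x = [] then p [] else inflow (iter n) x / out x)"

lemma iter_le_p: "iter n x \<le> p x"
proof (induction n arbitrary: x)
  case (Suc n)
  have "inflow (iter n) x \<le> p x * out x"
    using inflow_mono[of "iter n" p x] Suc by (simp add: p_balance)
  then show ?case using out_pos[of x] by (simp add: divide_le_eq)
qed (simp add: p_nonneg)

lemma iter_mono: "iter n x \<le> iter (Suc n) x"
proof (induction n arbitrary: x)
  case 0
  then show ?case
    using out_pos[of x]
    by (auto simp: p_nonneg inflow_def in_arr_def in_dep_def less_imp_le)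
next
  case (Suc n)
  have "inflow (iter n) x \<le> inflow (iter (Suc n)) x" using Suc by (rule inflow_mono)
  then show ?case using out_pos[of x]
    unfolding iter.simps(2)[of n] iter.simps(2)[of "Suc n"] by (simp add: divide_right_mono less_imp_le)
qed

lemma skeletal_iter: "skeletal lam Tc (iter n)"
proof (induction n)
  case 0
  show ?case by (rule skeletalI[where R = "\<lambda>_. 0"]) simp
next
  case (Suc n)
  have 1: "skeletal lam Tc (\<lambda>x. if x = [] then p [] else 0)"
    by (rule skeletalI[where R = "\<lambda>m. if m = [] then p [] else 0"]) simp
  have 2: "skeletal lam Tc (\<lambda>x. (if x = [] then 0 else 1 / out x) * inflow (iter n) x)"
    by (rule skeletal_mult[OF skeletal_inflow[OF Suc], where
          H = "\<lambda>m. if m = [] then 0 else 1 / (Lam + eta (length m) * kf s (sk_toks m))"])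
      (simp add: out_eq dep_total_def toks_eq_sk_toks)
  have "iter (Suc n) = (\<lambda>x. (if x = [] then p [] else 0) + (if x = [] then 0 else 1 / out x) * inflow (iter n) x)"
    by auto
  then show ?case using skeletal_add[OF 1 2] by simp
qed

theorem skeletal_stationary: "skeletal lam Tc p"
proof -
  have "\<exists>L. (\<lambda>n. iter n x) \<longlonglongrightarrow> L" for x
    using incseq_convergent[of "\<lambda>n. iter n x" "p x"] iter_mono iter_le_p
    by (metis incseq_SucI)
  then obtain g where g: "\<And>x. (\<lambda>n. iter n x) \<longlonglongrightarrow> g x" by metis
  have "skeletal lam Tc g" by (rule skeletal_LIMSEQ[OF skeletal_iter g])
  have g_le: "g x \<le> p x" for x by (rule LIMSEQ_le_const2[OF g]) (auto intro: iter_le_p)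
  have g_Nil: "g [] = p []"
  proof (rule LIMSEQ_unique[OF g])
    show "(\<lambda>n. iter n []) \<longlonglongrightarrow> p []" by (rule LIMSEQ_offset[where k = 1]) simp
  qed
  \<comment> \<open>The inflow into a state is a finite sum, so it commutes with the pointwise
    limit. The empty state is left out because the iteration prescribes the value there.\<close>
  have g_balance: "inflow g x = g x * out x" if "x \<noteq> []" for x
  proof -
    have "(\<lambda>n. inflow (iter n) x / out x) \<longlonglongrightarrow> inflow g x / out x"
      unfolding inflow_def in_arr_def in_dep_def if_not_P[OF that]
      using out_pos[of x] by (intro tendsto_intros g) simp
    moreover have "(\<lambda>n. inflow (iter n) x / out x) \<longlonglongrightarrow> g x"
      using LIMSEQ_Suc[OF g[of x]] that by simp
    ultimately have "inflow g x / out x = g x" by (rule LIMSEQ_unique)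
    then show ?thesis using out_pos[of x] by (simp add: field_simps)
  qed
  define d where "d x = p x - g x" for x
  have d_nonneg: "d x \<ge> 0" for x using g_le by (simp add: d_def)
  have g_nonneg: "g x \<ge> 0" for x
  proof (rule LIMSEQ_le_const[OF g])
    have "0 \<le> iter n x" for n
      using lift_Suc_mono_le[of "\<lambda>n. iter n x" 0 n] iter_mono by simp
    then show "\<exists>N. \<forall>n\<ge>N. 0 \<le> iter n x" by blast
  qed
  have d_le: "d x \<le> p x" for x using g_nonneg by (simp add: d_def)
  have d_balance: "inflow d x = d x * out x" if "x \<noteq> []" for x
    using p_balance[of x] g_balance[OF that]
    by (simp add: inflow_def in_arr_def in_dep_def d_def left_diff_distrib sum_subtractf that)
  define U where "U n = Lam * (\<Sum>y\<in>level n. d y)" for n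
  define B where "B n = (\<Sum>y\<in>level n. d y * dep_total y)" for n
  have U0: "U 0 = 0" by (simp add: U_def d_def g_Nil)
  \<comment> \<open>\<open>B (Suc n)\<close> flows down and \<open>U n\<close> flows up through the
    same cut; the constant difference is \<open>B 1\<close> because \<open>U 0 = 0\<close>.\<close>
  have flow: "B (Suc n) = U n + B 1" for n
  proof (induction n)
    case (Suc n)
    have "B (Suc (Suc n)) - U (Suc n) = B (Suc n) - U n"
      unfolding B_def U_def by (rule level_flow_step) (auto intro: d_balance)
    then show ?case using Suc by simp
  qed (simp add: U0)
  \<comment> \<open>As \<open>U n \<ge> 0\<close>, \<open>B 1\<close> is at most
    \<open>B (Suc n)\<close>, hence at most the downward flow of \<open>p\<close> out of level
    \<open>Suc n\<close>, which \<open>p_level_flow\<close> evaluates.\<close>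
  have "B 1 \<le> Lam * (\<Sum>y\<in>level n. p y)" for n
  proof -
    have "B (Suc n) \<le> (\<Sum>y\<in>level (Suc n). p y * dep_total y)"
      unfolding B_def by (intro sum_mono mult_right_mono d_le dep_total_nonneg)
    moreover have "U n \<ge> 0"
      unfolding U_def by (intro mult_nonneg_nonneg[OF less_imp_le[OF Lam_pos]] sum_nonneg d_nonneg)
    ultimately show ?thesis using flow[of n] by (simp add: p_level_flow)
  qed
  moreover have "(\<lambda>n. Lam * (\<Sum>y\<in>level n. p y)) \<longlonglongrightarrow> Lam * 0"
    by (intro tendsto_intros level_sums_tendsto_0)
  ultimately have "B 1 \<le> 0" using LIMSEQ_le_const by fastforce
  moreover have "B 1 \<ge> 0"
    unfolding B_def by (intro sum_nonneg mult_nonneg_nonneg d_nonneg dep_total_nonneg)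
  ultimately have B: "B (Suc n) = U n" for n using flow[of n] by simp
  \<comment> \<open>If \<open>d\<close> vanishes on level \<open>n\<close>, then
    \<open>B (Suc n) = U n = 0\<close>, and all its non-negative terms vanish. Where
    \<open>p\<close> is non-zero \<open>dep_total\<close> is positive; elsewhere \<open>d\<close>
    lies between 0 and \<open>p\<close>.\<close>
  have zero: "\<forall>x\<in>level n. d x = 0" for n
  proof (induction n)
    case (Suc n)
    then have "B (Suc n) = 0" by (simp add: B U_def)
    then have *: "\<forall>y\<in>level (Suc n). d y * dep_total y = 0"
      unfolding B_def
      by (subst (asm) sum_nonneg_eq_0_iff) (auto intro!: mult_nonneg_nonneg d_nonneg dep_total_nonneg)
    show ?case
    proof
      fix y :: "('c, 't) dstate" assume y: "y \<in> level (Suc n)"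
      show "d y = 0"
      proof (cases "p y = 0")
        case True
        then show ?thesis using d_le[of y] d_nonneg[of y] by simp
      next
        case False
        then have "dep_total y > 0" using p_support dep_total_pos y by fastforce
        then show ?thesis using * y by auto
      qed
    qed
  qed (simp add: d_def g_Nil)
  have "p = g" using zero by (auto simp: d_def)
  then show ?thesis using \<open>skeletal lam Tc g\<close> by simp
qed

end

section \<open>Generating functions\<close>

definition zprod :: "('c \<Rightarrow> complex) \<Rightarrow> ('c, 't) dstate \<Rightarrow> complex" where
  "zprod z x = prod_list (map (z \<circ> fst) x)"

lemma zprod_simps [simp]: "zprod z [] = 1" "zprod z (e # x) = z (fst e) * zprod z x"
  by (simp_all add: zprod_def)

lemma prod_power_ncust:
  fixes z :: "'c::finite \<Rightarrow> complex"
  shows "(\<Prod>c\<in>UNIV. z c ^ ncust c x) = zprod z x"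
proof (induction x)
  case (Cons e x)
  have "(\<Prod>c\<in>UNIV. z c ^ ncust c (e # x))
      = (\<Prod>c\<in>UNIV. (if c = fst e then z c else 1) * z c ^ ncust c x)"
    by (intro prod.cong) (auto simp: ncust_def)
  also have "\<dots> = z (fst e) * (\<Prod>c\<in>UNIV. z c ^ ncust c x)"
    by (simp add: prod.distrib)
  finally show ?case using Cons by simp
qed (simp add: ncust_def)

lemma norm_zprod_le: "(\<And>c. norm (z c) \<le> 1) \<Longrightarrow> norm (zprod z x) \<le> 1"
  by (induction x) (auto simp: norm_mult mult_le_one)

section \<open>Skeletons of aggregated states with given holder types\<close>

fun skel :: "'t list \<Rightarrow> nat list \<Rightarrow> 'c list \<Rightarrow> ('c \<times> 't) option list" where
  "skel (t # ts) (n # ns) (c # cs) = Some (c, t) # replicate n None @ skel ts ns cs"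
| "skel _ _ _ = []"

lemma fst_agg: "fst (agg x) = toks x"
  by (induction x rule: agg.induct) auto

lemma length_snd_agg: "length (snd (agg x)) = length (toks x)"
  by (induction x rule: agg.induct) auto

lemma htypes_simps [simp]:
  "htypes [] = []" "htypes ((c, Some t) # x) = c # htypes x" "htypes ((c, None) # x) = htypes x"
  by (simp_all add: htypes_def active_def)

lemma length_htypes: "length (htypes x) = length (toks x)"
  by (simp add: htypes_def toks_def)

text \<open>\<open>agg\<close> skips tokenless customers in front of the first token holder, hence
  the leading block.\<close>

lemma sk_eq_skel:
  "sk x = replicate (length (takeWhile (\<lambda>e. snd e = None) x)) None
     @ skel (fst (agg x)) (snd (agg x)) (htypes x)"
  by (induction x rule: agg.induct) auto

lemma skel_cases: "skel ts ns cs = [] \<or> (\<exists>e m. skel ts ns cs = Some e # m)"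
  by (cases "(ts, ns, cs)" rule: skel.cases) auto

text \<open>The decomposition is unique since \<open>skel\<close> is empty or starts with a token
  holder; the length assumptions keep \<open>skel\<close> from truncating its arguments.\<close>

lemma agg_of_sk:
  assumes "sk x = replicate m None @ skel ts ns cs" "length ns = length ts" "length cs = length ts"
  shows "agg x = (ts, ns) \<and> htypes x = cs \<and> length (takeWhile (\<lambda>e. snd e = None) x) = m"
  using assms
proof (induction x arbitrary: m ts ns cs)
  case Nil
  then show ?case by (cases "(ts, ns, cs)" rule: skel.cases) auto
next
  case (Cons e x)
  obtain c h where e: "e = (c, h)" by (cases e)
  show ?case
  proof (cases h)
    case None
    then obtain m' where m: "m = Suc m'"
      using Cons.prems(1) skel_cases[of ts ns cs] by (cases m) (auto simp: e)
    then show ?thesis using Cons.IH[of m' ts ns cs] Cons.prems None by (simp add: e)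
  next
    case (Some t)
    then have "m = 0" using Cons.prems(1) by (cases m) (auto simp: e)
    then obtain ts' n ns' cs' where "ts = t # ts'" "ns = n # ns'" "cs = c # cs'"
        "sk x = replicate n None @ skel ts' ns' cs'"
      using Cons.prems(1) Some by (cases "(ts, ns, cs)" rule: skel.cases) (auto simp: e)
    then show ?thesis using Cons.IH[of n ts' ns' cs'] Cons.prems Some \<open>m = 0\<close> by (simp add: e)
  qed
qed

lemma finite_sk_fiber [simp]: "finite {x :: ('c::finite, 't::finite) dstate. sk x = m}"
  by (rule finite_subset[OF _ finite_level[of "length m"]]) auto

lemma infsum_fibers:
  fixes f :: "'a \<Rightarrow> 'b::banach"
  assumes "f summable_on A" "g ` A \<subseteq> B"
  shows "infsum f A = (\<Sum>\<^sub>\<infinity>b\<in>B. infsum f {x \<in> A. g x = b})"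
proof -
  let ?S = "Sigma B (\<lambda>b. {x \<in> A. g x = b})"
  have bij: "bij_betw snd ?S A"
    by (rule bij_betw_byWitness[where f' = "\<lambda>x. (g x, x)"]) (use assms(2) in auto)
  have "infsum f A = infsum (\<lambda>x. f (snd x)) ?S"
    using infsum_reindex_bij_betw[OF bij, of f] by simp
  moreover have "(\<lambda>x. f (snd x)) summable_on ?S"
    using summable_on_reindex_bij_betw[OF bij, of f] assms(1) by simp
  ultimately show ?thesis using infsum_Sigma_banach[of "\<lambda>x. f (snd x)" B "\<lambda>b. {x \<in> A. g x = b}"]
    by simp
qed

lemma prod_atLeast1_add:
  fixes f :: "nat \<Rightarrow> 'a::comm_monoid_mult"
  shows "(\<Prod>m=1..a + b. f m) = (\<Prod>m=1..a. f m) * (\<Prod>m=1..b. f (a + m))"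
  by (induction b) (simp_all add: mult.assoc)

section \<open>Generating functions over the states with a fixed skeleton\<close>

context token_queue
begin

text \<open>If \<open>p\<close> is skeletal with factor \<open>R\<close>, then
  \<open>R m * gen z {} m\<close> is the contribution of the skeleton \<open>m\<close> to the
  generating function.\<close>

definition gen :: "('c \<Rightarrow> complex) \<Rightarrow> 't set \<Rightarrow> ('c \<times> 't) option list \<Rightarrow> complex" where
  "gen z S m = (\<Sum>x | sk x = m. complex_of_real (wt lam Tc S x) * zprod z x)"

text \<open>Unnormalised generating function of the type of one tokenless customer standing behind
  the tokens \<open>S\<close>.\<close>

definition lamz :: "('c \<Rightarrow> complex) \<Rightarrow> 't set \<Rightarrow> complex" where
  "lamz z S = (\<Sum>c\<in>UNIV. if Tc c \<subseteq> S then complex_of_real (lam c) * z c else 0)"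

lemma gen_Nil: "gen z S [] = 1"
  by (simp add: gen_def)

lemma gen_Some: "gen z S (Some (c, t) # m) = (if t \<in> S then 0 else z c * gen z (insert t S) m)"
proof -
  have "{x. sk x = Some (c, t) # m} = (#) (c, Some t) ` {x. sk x = m}"
    by (auto simp: sk_def map_eq_Cons_conv)
  then have "gen z S (Some (c, t) # m)
      = (\<Sum>x | sk x = m. complex_of_real (wt lam Tc S ((c, Some t) # x)) * zprod z ((c, Some t) # x))"
    unfolding gen_def by (simp add: sum.reindex del: wt.simps zprod_simps)
  then show ?thesis by (simp add: gen_def sum_distrib_left mult_ac)
qed

lemma gen_None: "gen z S (None # m) = lamz z S * gen z S m"
proof -
  have eq: "{x. sk x = None # m} = (\<lambda>(c, x). (c, None) # x) ` (UNIV \<times> {x. sk x = m})"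
    by (auto simp: sk_def map_eq_Cons_conv image_iff)
  have "inj_on (\<lambda>(c :: 'c, x). (c, None :: 't option) # x) (UNIV \<times> {x. sk x = m})"
    by (auto simp: inj_on_def)
  then have "gen z S (None # m) = (\<Sum>(c, x)\<in>UNIV \<times> {x. sk x = m}.
      complex_of_real (wt lam Tc S ((c, None) # x)) * zprod z ((c, None) # x))"
    unfolding gen_def eq by (simp add: sum.reindex case_prod_unfold del: wt.simps zprod_simps)
  also have "\<dots> = (\<Sum>c\<in>UNIV. \<Sum>x | sk x = m.
      (if Tc c \<subseteq> S then complex_of_real (lam c) * z c else 0) * (complex_of_real (wt lam Tc S x) * zprod z x))"
    unfolding sum.cartesian_product[symmetric] by (intro sum.cong) auto
  also have "\<dots> = lamz z S * gen z S m"
    by (simp add: lamz_def gen_def sum_product)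
  finally show ?thesis .
qed

lemma gen_replicate_None: "gen z S (replicate n None @ m) = lamz z S ^ n * gen z S m"
  by (induction n) (simp_all add: gen_None)

text \<open>The tokenless customers in gap \<open>j\<close>, counted from 0, stand behind the first
  \<open>Suc j\<close> token holders, and each contributes its own factor
  \<open>lamz\<close>.\<close>

lemma gen_skel:
  assumes "length ns = length ts" "length cs = length ts" "distinct ts" "set ts \<inter> S = {}"
  shows "gen z S (skel ts ns cs) = (\<Prod>j<length ts. z (cs ! j))
     * (\<Prod>j<length ts. lamz z (S \<union> set (take (Suc j) ts)) ^ (ns ! j))"
  using assms
proof (induction ts ns cs arbitrary: S rule: skel.induct)
  case (1 t ts n ns c cs)
  have "gen z S (skel (t # ts) (n # ns) (c # cs))
     = z c * (lamz z (insert t S) ^ n * gen z (insert t S) (skel ts ns cs))"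
    using "1.prems" by (simp add: gen_Some gen_replicate_None)
  also have "gen z (insert t S) (skel ts ns cs) = (\<Prod>j<length ts. z (cs ! j))
     * (\<Prod>j<length ts. lamz z (insert t S \<union> set (take (Suc j) ts)) ^ (ns ! j))"
    using "1.prems" by (intro "1.IH") auto
  finally show ?case
    by (simp add: prod.lessThan_Suc_shift del: prod.lessThan_Suc)
qed (auto simp: gen_Nil)

text \<open>If \<open>lamU\<close> is 0, positivity of the rates leaves no type confined to these
  tokens, so both sides vanish.\<close>

lemma lamz_theta:
  "lamz z (set (take j ts))
    = complex_of_real (lamU lam Tc (set (take j ts))) * (\<Sum>c\<in>UNIV. complex_of_real (theta lam Tc ts j c) * z c)"
proof (cases "lamU lam Tc (set (take j ts)) = 0")
  case True
  then have "{c. Tc c \<subseteq> set (take j ts)} = {}"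
    using sum_pos[of "{c. Tc c \<subseteq> set (take j ts)}" lam] lam_pos unfolding lamU_def by fastforce
  then show ?thesis using True by (auto simp: lamz_def)
next
  case False
  then show ?thesis
    unfolding lamz_def sum_distrib_left by (intro sum.cong) (auto simp: theta_def)
qed

lemma lamz_1: "lamz (\<lambda>_. 1) S = complex_of_real (lamU lam Tc S)"
  unfolding lamz_def lamU_def by (simp add: sum.If_cases)

text \<open>Given the skeleton, the types of the tokenless customers are independent, those in the
  \<open>j\<close>-th gap being distributed according to \<^term>\<open>theta lam Tc ts j\<close>.\<close>

lemma gen_skel_theta:
  assumes "length ns = length ts" "length cs = length ts" "distinct ts"
  shows "gen z {} (skel ts ns cs) = gen (\<lambda>_. 1) {} (skel ts ns cs) * (\<Prod>j<length ts. z (cs ! j))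
     * (\<Prod>j<length ts. (\<Sum>c\<in>UNIV. complex_of_real (theta lam Tc ts (Suc j) c) * z c) ^ (ns ! j))"
  using assms by (simp add: gen_skel lamz_1 lamz_theta[of z] power_mult_distrib prod.distrib)

end

section \<open>Splitting the expectation by aggregated state and holder types\<close>

context stationary_token_queue
begin

definition class_mass :: "'t list \<Rightarrow> nat list \<Rightarrow> 'c list \<Rightarrow> real" where
  "class_mass ts ns cs = (\<Sum>\<^sub>\<infinity>x\<in>{x. agg x = (ts, ns) \<and> htypes x = cs}. p x)"

lemma p_summable: "p summable_on A"
  using p_has_sum summable_on_subset_banach has_sum_imp_summable by (metis subset_UNIV)

text \<open>The class and the finite fibre of its skeleton differ only by states that begin with a
  tokenless customer; there \<open>w\<close>, and hence \<open>p\<close>, vanishes.\<close>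

lemma infsum_class:
  fixes h :: "('c, 't) dstate \<Rightarrow> 'b::{topological_comm_monoid_add, t2_space}"
  assumes "length ns = length ts" "length cs = length ts" "\<And>x. p x = 0 \<Longrightarrow> h x = 0"
  shows "(\<Sum>\<^sub>\<infinity>x\<in>{x. agg x = (ts, ns) \<and> htypes x = cs}. h x) = (\<Sum>x | sk x = skel ts ns cs. h x)"
proof -
  have "(\<Sum>\<^sub>\<infinity>x\<in>{x. agg x = (ts, ns) \<and> htypes x = cs}. h x) = infsum h {x. sk x = skel ts ns cs}"
  proof (rule infsum_cong_neutral)
    fix x assume x: "x \<in> {x. agg x = (ts, ns) \<and> htypes x = cs} - {x. sk x = skel ts ns cs}"
    have "w x = 0"
    proof (cases x)
      case Nil
      then show ?thesis using x by auto
    next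
      case (Cons e y)
      have "snd e = None"
        using x sk_eq_skel[of x] Cons by (cases "snd e = None") auto
      then have "e = (fst e, None)" by (simp add: prod_eq_iff)
      then have "w x = (if Tc (fst e) \<subseteq> {} then lam (fst e) else 0) * w y"
        using Cons by (metis wt.simps(3))
      then show ?thesis using Tc_ne by simp
    qed
    then show "h x = 0" using p_support assms(3) by blast
  next
    fix x assume "x \<in> {x. sk x = skel ts ns cs} - {x. agg x = (ts, ns) \<and> htypes x = cs}"
    then show "h x = 0" using agg_of_sk[of x 0 ts ns cs] assms by simp
  qed simp
  then show ?thesis by simp
qed

lemma infsum_class_zprod:
  assumes "length ns = length ts" "length cs = length ts" "distinct ts"
  shows "(\<Sum>\<^sub>\<infinity>x\<in>{x. agg x = (ts, ns) \<and> htypes x = cs}. complex_of_real (p x) * zprod z x)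
    = complex_of_real (class_mass ts ns cs) * (\<Prod>j<length ts. z (cs ! j))
     * (\<Prod>j<length ts. (\<Sum>c\<in>UNIV. complex_of_real (theta lam Tc ts (Suc j) c) * z c) ^ (ns ! j))"
proof -
  obtain R where R: "\<And>x. p x = R (sk x) * w x"
    using skeletal_stationary unfolding skeletal_def by blast
  let ?m = "skel ts ns cs"
  have sum: "(\<Sum>x | sk x = ?m. complex_of_real (p x) * zprod v x) = complex_of_real (R ?m) * gen v {} ?m" for v
    unfolding gen_def sum_distrib_left by (intro sum.cong) (auto simp: R)
  \<comment> \<open>Evaluation at \<open>z = 1\<close> identifies the unknown constant
    \<open>R ?m * gen (\<lambda>_. 1) {} ?m\<close> with the mass of the class.\<close>
  have "zprod (\<lambda>_. 1) x = 1" for x :: "('c, 't) dstate" by (induction x) auto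
  then have "complex_of_real (class_mass ts ns cs) = complex_of_real (R ?m) * gen (\<lambda>_. 1) {} ?m"
    using sum[of "\<lambda>_. 1"] assms by (simp add: class_mass_def infsum_class)
  then show ?thesis
    using assms by (simp add: infsum_class sum gen_skel_theta[of ns ts cs z] mult.assoc)
qed

text \<open>If \<open>pagg p ts ns\<close> is 0, the class mass, which lies between 0 and
  \<open>pagg p ts ns\<close>, is 0 as well, so the value of the quotient does not matter.\<close>

lemma pagg_mult_Gcond: "pagg p ts ns * Gcond p cs ts ns = class_mass ts ns cs"
proof -
  have "class_mass ts ns cs \<le> pagg p ts ns"
    unfolding class_mass_def pagg_def
    by (rule infsum_mono_neutral) (auto simp: p_summable p_nonneg)
  moreover have "class_mass ts ns cs \<ge> 0"
    unfolding class_mass_def by (rule infsum_nonneg) (simp add: p_nonneg)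
  ultimately show ?thesis
    by (cases "pagg p ts ns = 0") (auto simp: Gcond_def class_mass_def)
qed

lemma infsum_agg_decomposition:
  assumes "\<And>c. norm (z c) \<le> 1"
  shows "(\<Sum>\<^sub>\<infinity>x. complex_of_real (p x) * zprod z x) =
    (\<Sum>ts | distinct ts. \<Sum>\<^sub>\<infinity>ns\<in>{ns. length ns = length ts}. \<Sum>cs | length cs = length ts.
       \<Sum>\<^sub>\<infinity>x\<in>{x. agg x = (ts, ns) \<and> htypes x = cs}. complex_of_real (p x) * zprod z x)"
proof -
  let ?F = "\<lambda>x. complex_of_real (p x) * zprod z x"
  \<comment> \<open>Domination by \<open>p\<close> gives absolute summability, which permits
    regrouping by tokens, then gap sizes, then holder types.\<close>
  have abs: "(\<lambda>x. norm (?F x)) summable_on UNIV"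
  proof (rule Infinite_Sum.abs_summable_on_comparison_test)
    show "(\<lambda>x. norm (p x)) summable_on UNIV" using p_summable by (simp add: p_nonneg)
    show "norm (?F x) \<le> norm (p x)" for x
      using mult_left_le[OF norm_zprod_le[of z x] p_nonneg[of x]] assms
      by (simp add: norm_mult p_nonneg)
  qed
  have sm: "?F summable_on A" for A
    by (rule summable_on_subset_banach[OF abs_summable_summable[OF abs]]) simp
  have fin: "finite {ts :: 't list. distinct ts}"
    by (rule finite_subset[OF _ finite_lists_length_le[OF finite[of "UNIV :: 't set"], of "CARD('t)"]])
      (auto simp: distinct_card[symmetric] intro!: card_mono)
  have fin': "finite {cs :: 'c list. length cs = n}" for n
    using finite_lists_length_eq[OF finite[of "UNIV :: 'c set"], of n] by simp
  \<comment> \<open>States with a repeated token have \<open>p x = 0\<close>, so only finitely many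
    token lists remain.\<close>
  have "infsum ?F UNIV = infsum ?F {x. distinct (toks x)}"
    by (rule infsum_cong_neutral) (use p_support wt_distinct in fastforce)+
  also have "\<dots> = (\<Sum>\<^sub>\<infinity>ts\<in>{ts. distinct ts}. infsum ?F {x \<in> {x. distinct (toks x)}. toks x = ts})"
    by (rule infsum_fibers[OF sm]) auto
  also have "\<dots> = (\<Sum>ts | distinct ts. infsum ?F {x. toks x = ts})"
    using fin by (simp, intro sum.cong refl arg_cong2[where f = infsum]) auto
  also have "\<dots> = (\<Sum>ts | distinct ts. \<Sum>\<^sub>\<infinity>ns\<in>{ns. length ns = length ts}. infsum ?F {x. agg x = (ts, ns)})"
  proof (rule sum.cong[OF refl])
    fix ts :: "'t list"
    have "infsum ?F {x. toks x = ts}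
        = (\<Sum>\<^sub>\<infinity>ns\<in>{ns. length ns = length ts}. infsum ?F {x \<in> {x. toks x = ts}. snd (agg x) = ns})"
      by (rule infsum_fibers[OF sm]) (auto simp: length_snd_agg)
    moreover have "{x :: ('c, 't) dstate. x \<in> {x. toks x = ts} \<and> snd (agg x) = ns} = {x. agg x = (ts, ns)}" for ns
      by (auto simp: prod_eq_iff fst_agg)
    ultimately show "infsum ?F {x. toks x = ts}
        = (\<Sum>\<^sub>\<infinity>ns\<in>{ns. length ns = length ts}. infsum ?F {x. agg x = (ts, ns)})" by simp
  qed
  also have "\<dots> = (\<Sum>ts | distinct ts. \<Sum>\<^sub>\<infinity>ns\<in>{ns. length ns = length ts}. \<Sum>cs | length cs = length ts.
       infsum ?F {x. agg x = (ts, ns) \<and> htypes x = cs})"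
  proof (intro sum.cong infsum_cong refl)
    fix ts :: "'t list" and ns :: "nat list"
    have "htypes ` {x. agg x = (ts, ns)} \<subseteq> {cs. length cs = length ts}"
      by (auto simp: length_htypes fst_agg[symmetric])
    then have "infsum ?F {x. agg x = (ts, ns)}
        = (\<Sum>\<^sub>\<infinity>cs\<in>{cs. length cs = length ts}. infsum ?F {x \<in> {x. agg x = (ts, ns)}. htypes x = cs})"
      by (rule infsum_fibers[OF sm])
    then show "infsum ?F {x. agg x = (ts, ns)}
        = (\<Sum>cs | length cs = length ts. infsum ?F {x. agg x = (ts, ns) \<and> htypes x = cs})"
      by (simp add: fin')
  qed
  finally show ?thesis .
qed

end

theorem mainTheorem4:
  fixes lam :: "'c::finite \<Rightarrow> real"
    and Tc :: "'c \<Rightarrow> 't::finite set"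
    and assign :: "'c \<Rightarrow> 't set \<Rightarrow> 't \<Rightarrow> real"
    and s :: "'t list \<Rightarrow> real"
    and eta :: "nat \<Rightarrow> real"
    and p :: "('c, 't) dstate \<Rightarrow> real"
    and z :: "'c \<Rightarrow> complex"
  assumes lam_pos: "\<forall>c. lam c > 0"
    and Tc_ne: "\<forall>c. Tc c \<noteq> {}"
    and assign_nonneg: "\<forall>c R t. assign c R t \<ge> 0"
    and assign_supp: "\<forall>c R t. t \<notin> Tc c - R \<longrightarrow> assign c R t = 0"
    and assign_sum: "\<forall>c R. Tc c - R \<noteq> {} \<longrightarrow> (\<Sum>t\<in>UNIV. assign c R t) = 1"
    and assignment_cond: "\<forall>xs ys. distinct xs \<longrightarrow> distinct ys \<longrightarrow> set xs = set ys \<longrightarrow>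
                               prodlam lam assign xs = prodlam lam assign ys"
    and s_nonneg: "\<forall>ts. s ts \<ge> 0"
    and k_perm: "\<forall>xs ys. distinct xs \<longrightarrow> distinct ys \<longrightarrow> set xs = set ys \<longrightarrow> kf s xs = kf s ys"
    and k_pos: "\<forall>ts. distinct ts \<longrightarrow> ts \<noteq> [] \<longrightarrow> kf s ts > 0"
    and eta_pos: "\<forall>m. eta m > 0"
    and stat: "stationary lam Tc assign s eta p"
    and product_form: "\<forall>ts ns. distinct ts \<longrightarrow> length ns = length ts \<longrightarrow>
           pagg p ts ns = p [] * Pi_lam lam assign (set ts) / Pi_k s ts
              * (\<Prod>j<length ts. alpha lam Tc s ts (Suc j) ^ (ns ! j))
              * (\<Prod>m=1..length ts + sum_list ns. 1 / eta m)"
    and z_lt: "\<forall>c. norm (z c) < 1"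
  shows "(\<Sum>\<^sub>\<infinity>x. complex_of_real (p x) * (\<Prod>c\<in>UNIV. z c ^ ncust c x)) =
    (\<Sum>ts\<in>{ts. distinct ts}.
       complex_of_real (p [] * Pi_lam lam assign (set ts) / Pi_k s ts * (\<Prod>j=1..length ts. 1 / eta j))
       * (\<Sum>\<^sub>\<infinity>ns\<in>{ns. length ns = length ts}.
            (\<Sum>cs\<in>{cs. length cs = length ts}.
               complex_of_real (Gcond p cs ts ns) * (\<Prod>j<length ts. z (cs ! j)))
            * complex_of_real (\<Prod>m=1..sum_list ns. 1 / eta (length ts + m))
            * (\<Prod>j<length ts. (complex_of_real (alpha lam Tc s ts (Suc j))
                 * (\<Sum>c\<in>UNIV. complex_of_real (theta lam Tc ts (Suc j) c) * z c)) ^ (ns ! j))))"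
proof -
  interpret stationary_token_queue lam Tc assign s eta p
    using lam_pos Tc_ne assign_nonneg assign_supp assign_sum s_nonneg k_pos eta_pos stat
    by unfold_locales auto
  have "(\<Sum>\<^sub>\<infinity>x. complex_of_real (p x) * (\<Prod>c\<in>UNIV. z c ^ ncust c x))
      = (\<Sum>\<^sub>\<infinity>x. complex_of_real (p x) * zprod z x)"
    by (simp only: prod_power_ncust)
  also have "\<dots> = (\<Sum>ts | distinct ts. \<Sum>\<^sub>\<infinity>ns\<in>{ns. length ns = length ts}. \<Sum>cs | length cs = length ts.
       \<Sum>\<^sub>\<infinity>x\<in>{x. agg x = (ts, ns) \<and> htypes x = cs}. complex_of_real (p x) * zprod z x)"
    by (rule infsum_agg_decomposition) (simp add: z_lt less_imp_le)
  also have "\<dots> = (\<Sum>ts\<in>{ts. distinct ts}.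
       complex_of_real (p [] * Pi_lam lam assign (set ts) / Pi_k s ts * (\<Prod>j=1..length ts. 1 / eta j))
       * (\<Sum>\<^sub>\<infinity>ns\<in>{ns. length ns = length ts}.
            (\<Sum>cs\<in>{cs. length cs = length ts}.
               complex_of_real (Gcond p cs ts ns) * (\<Prod>j<length ts. z (cs ! j)))
            * complex_of_real (\<Prod>m=1..sum_list ns. 1 / eta (length ts + m))
            * (\<Prod>j<length ts. (complex_of_real (alpha lam Tc s ts (Suc j))
                 * (\<Sum>c\<in>UNIV. complex_of_real (theta lam Tc ts (Suc j) c) * z c)) ^ (ns ! j))))"
    \<comment> \<open>The prefactor is moved into the sum over \<open>ns\<close>, so that both sides
      can be compared for each \<open>ts\<close> and \<open>ns\<close>.\<close>
    unfolding infsum_cmult_right'[symmetric]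
  proof (intro sum.cong infsum_cong refl)
    fix ts :: "'t list" and ns :: "nat list"
    assume "ts \<in> {ts. distinct ts}" and "ns \<in> {ns. length ns = length ts}"
    then have dist: "distinct ts" and len: "length ns = length ts" by auto
    define C where "C = p [] * Pi_lam lam assign (set ts) / Pi_k s ts * (\<Prod>j=1..length ts. 1 / eta j)"
    define E where "E = (\<Prod>m=1..sum_list ns. 1 / eta (length ts + m))"
    define A where "A = (\<Prod>j<length ts. alpha lam Tc s ts (Suc j) ^ (ns ! j))"
    define Z where "Z cs = (\<Prod>j<length ts. z (cs ! j))" for cs
    define V where "V = (\<Prod>j<length ts. (\<Sum>c\<in>UNIV. complex_of_real (theta lam Tc ts (Suc j) c) * z c) ^ (ns ! j))"
    \<comment> \<open>The product of \<open>1 / eta m\<close> in the product form is cut at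
      \<open>length ts\<close>: the first part belongs to \<open>C\<close>, the rest is
      \<open>E\<close>.\<close>
    have "pagg p ts ns = C * E * A"
      using product_form dist len
      by (simp add: prod_atLeast1_add[of "\<lambda>m. 1 / eta m" "length ts" "sum_list ns", simplified]
          C_def E_def A_def mult_ac)
    then have mass: "complex_of_real (class_mass ts ns cs)
        = complex_of_real C * complex_of_real E * complex_of_real A * complex_of_real (Gcond p cs ts ns)" for cs
      by (simp flip: pagg_mult_Gcond of_real_mult)
    have "(\<Sum>cs | length cs = length ts. \<Sum>\<^sub>\<infinity>x\<in>{x. agg x = (ts, ns) \<and> htypes x = cs}. complex_of_real (p x) * zprod z x)
        = (\<Sum>cs | length cs = length ts. complex_of_real (class_mass ts ns cs) * Z cs * V)"
      by (intro sum.cong) (auto simp: infsum_class_zprod len dist Z_def V_def)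
    also have "\<dots> = complex_of_real C * ((\<Sum>cs | length cs = length ts. complex_of_real (Gcond p cs ts ns) * Z cs)
        * complex_of_real E * (complex_of_real A * V))"
      by (simp add: mass sum_distrib_left sum_distrib_right mult_ac)
    also have "complex_of_real A * V = (\<Prod>j<length ts. (complex_of_real (alpha lam Tc s ts (Suc j))
                 * (\<Sum>c\<in>UNIV. complex_of_real (theta lam Tc ts (Suc j) c) * z c)) ^ (ns ! j))"
      by (simp add: A_def V_def power_mult_distrib prod.distrib)
    finally show "(\<Sum>cs | length cs = length ts. \<Sum>\<^sub>\<infinity>x\<in>{x. agg x = (ts, ns) \<and> htypes x = cs}. complex_of_real (p x) * zprod z x)
      = complex_of_real (p [] * Pi_lam lam assign (set ts) / Pi_k s ts * (\<Prod>j=1..length ts. 1 / eta j))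
       * ((\<Sum>cs\<in>{cs. length cs = length ts}.
               complex_of_real (Gcond p cs ts ns) * (\<Prod>j<length ts. z (cs ! j)))
            * complex_of_real (\<Prod>m=1..sum_list ns. 1 / eta (length ts + m))
            * (\<Prod>j<length ts. (complex_of_real (alpha lam Tc s ts (Suc j))
                 * (\<Sum>c\<in>UNIV. complex_of_real (theta lam Tc ts (Suc j) c) * z c)) ^ (ns ! j)))"
      unfolding C_def E_def Z_def .
  qed
  finally show ?thesis .
qed

end
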